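(* Let $\Lambda>0$, $\eta>0$, let $M\ge N\ge1$ be integers, and let $\ell=\Lambda/N$. For every design $x=(x_1,\dots,x_M)\in\mathbb{R}^M$ let $T_x:\mathbb{C}^N\to\mathbb{C}^M$ be the free Jacobian of the $N$-block model. Then: (1) $T_x=D_\gamma(x)\,F_x\,D_w$, where $(F_x)_{kj}=e^{ix_kj\ell}$ ($1\le k\le M$, $0\le j\le N-1$), $D_\gamma(x)=\operatorname{diag}(\gamma_1(x_1),\dots,\gamma_M(x_M))$ with $\gamma_k(x_k)=-2i\sin\!\big(\tfrac{(x_k+i\eta)\ell}{2}\big)e^{ix_k\ell/2}$, and $D_w=\operatorname{diag}(w_0,\dots,w_{N-1})$ with $w_j=e^{-\eta(j+\frac12)\ell}$. (2) For every $x\in\mathbb{R}^M$, $$\sigma_{\min}(T_x)\le2\sqrt M\,\cosh\!\Big(\frac{\eta\ell}{2}\Big)e^{-\eta(\Lambda-\ell/2)} .$$ (3) For the half-shifted equispaced design $x_k=\dfrac{2\pi(k-\frac12)}{M\ell}$, $k=1,\dots,M$, $$\sigma_{\min}(T_x)\ge2\sqrt M\,\sqrt{\sinh^2\!\Big(\frac{\eta\ell}{2}\Big)+\sin^2\!\Big(\frac{\pi}{2M}\Big)}\;e^{-\eta(\Lambda-\ell/2)} .$$ (4) Within the equispaced family $x_k(\alpha)=\frac{2\pi(k-1)}{M\ell}+\frac{2\alpha}{\ell}$ ($k=1,\dots,M$, $\alpha\in\mathbb{R}$), the half-shift $\alpha=\frac{\pi}{2M}$ maximizes the worst row factor $\alpha\mapsto\min_{1\le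 k\le M}|\gamma_k(x_k(\alpha))|$, and hence maximizes the product $\sigma_{\min}(D_\gamma(x(\alpha)))\,\sigma_{\min}(F_{x(\alpha)})\,\sigma_{\min}(D_w)$.
   Context: Let $J=\begin{pmatrix}0&-1\\1&0\end{pmatrix}$. A trace-normed Hamiltonian on $[0,\Lambda]$ is a measurable $H:[0,\Lambda]\to\mathbb{R}^{2\times2}$ with $H(s)$ symmetric, $H(s)\succeq0$ and $\operatorname{tr}H(s)=1$ for a.e. $s$; it is extended to $[0,\infty)$ by the free tail $H(s)=\frac12I$ for $s\ge\Lambda$. For $\operatorname{Im}z>0$, the Weyl coefficient $m_{H,\Lambda}(z)$ is the unique $m\in\mathbb{C}$ such that the solution of $JY'(s)=zH(s)Y(s)$ on $[0,\infty)$ with $Y(0)=(1,m)^\top$ is square-integrable, i.e. $\int_0^\infty Y^*HY\,ds<\infty$; it satisfies $\operatorname{Im}m_{H,\Lambda}(z)>0$. Its Schur transform is $v_{H,\Lambda}(z)=\dfrac{m_{H,\Lambda}(z)-i}{m_{H,\Lambda}(z)+i}$. For $q\in\mathbb{C}$, $X_q:=\begin{pmatrix}\operatorname{Re}q&\operatorname{Im}q\\ \operatorname{Im}q&-\operatorname{Re}q\end{pmatrix}$. Let $H_0\equiv\frac12I$. For $q\in L^\infty(0,\Lambda;\mathbb{C})$, $Dv_{H_0,\Lambda}(z)[q]$ is the derivative at $\tau=0$ (real $\tau$) of $\tau\mapsto v_{H_0+\tau X_q,\Lambda}(z)$. Block model: $[0,\Lambda]$ is partitioned into $I_j=[j\ell,(j+1)\ell)$,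 $0\le j\le N-1$, and a block parameter $q=(q_0,\dots,q_{N-1})\in\mathbb{C}^N$ corresponds to the Hamiltonian equal to $\frac12I+X_{q_j}$ on $I_j$. The free Jacobian $T_x:\mathbb{C}^N\to\mathbb{C}^M$ is the (complex-linear) map $(T_x\,\Delta q)_k=Dv_{H_0,\Lambda}(x_k+i\eta)\big[\sum_j\Delta q_j\mathbf{1}_{I_j}\big]$. $\sigma_{\min}(A)=\min_{\|u\|_2=1}\|Au\|_2$ is the least singular value. *)

theory Defs
  imports "HOL-Analysis.Analysis" "Jordan_Normal_Form.Matrix"
begin

(* HOL-Analysis vectors (complex^2, real^2^2) carry the canonical system, whose size is the
   fixed number 2.  Jordan_Normal_Form vectors and matrices carry C^N and C^M, since N and M
   are ordinary parameters. *)

definition J_mat :: "complex^2^2" where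
  "J_mat = vector [vector [0, -1], vector [1, 0]]"

definition trace_normed_hamiltonian :: "real \<Rightarrow> (real \<Rightarrow> real^2^2) \<Rightarrow> bool" where
  "trace_normed_hamiltonian \<Lambda> H \<longleftrightarrow>
     H \<in> borel_measurable (lebesgue_on {0..\<Lambda>}) \<and>
     (AE s in lebesgue_on {0..\<Lambda>}.
        transpose (H s) = H s \<and> (\<forall>v. 0 \<le> inner v (H s *v v)) \<and> trace (H s) = 1)"

definition free_hamiltonian :: "real \<Rightarrow> real^2^2" where
  "free_hamiltonian s = (1/2) *\<^sub>R Finite_Cartesian_Product.mat 1"

definition extend_free :: "real \<Rightarrow> (real \<Rightarrow> real^2^2) \<Rightarrow> real \<Rightarrow> real^2^2" where
  "extend_free \<Lambda> H s = (if s < \<Lambda> then H s else (1/2) *\<^sub>R Finite_Cartesian_Product.mat 1)"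

(* As H is only measurable, J Y' = z H Y on [0,oo) is read in the sense of Caratheodory:
   Y is locally absolutely continuous and the equation holds a.e., that is,
   J (Y t - Y 0) is the Lebesgue integral of z H Y over [0,t] for every t >= 0.
   The values of Y at negative arguments are irrelevant. *)
definition canonical_solution ::
  "(real \<Rightarrow> real^2^2) \<Rightarrow> complex \<Rightarrow> (real \<Rightarrow> complex^2) \<Rightarrow> bool" where
  "canonical_solution H z Y \<longleftrightarrow>
     (\<forall>t\<ge>0. (\<lambda>s. z *s (map_matrix complex_of_real (H s) *v Y s)) absolutely_integrable_on {0..t} \<and>
        J_mat *v (Y t - Y 0) =
          integral {0..t} (\<lambda>s. z *s (map_matrix complex_of_real (H s) *v Y s)))"

(* The integrand Y* H Y; it is real and nonnegative when H s is symmetric and positive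
   semidefinite. *)
definition energy_density :: "(real \<Rightarrow> real^2^2) \<Rightarrow> (real \<Rightarrow> complex^2) \<Rightarrow> real \<Rightarrow> complex" where
  "energy_density H Y s =
     (\<Sum>i\<in>UNIV. cnj (vec_nth (Y s) i) * vec_nth (map_matrix complex_of_real (H s) *v Y s) i)"

definition square_integrable_solution ::
  "(real \<Rightarrow> real^2^2) \<Rightarrow> complex \<Rightarrow> (real \<Rightarrow> complex^2) \<Rightarrow> bool" where
  "square_integrable_solution H z Y \<longleftrightarrow>
     canonical_solution H z Y \<and> energy_density H Y absolutely_integrable_on {0..}"

(* H is a Hamiltonian on [0,\<Lambda>]; only its values there enter.  The description is
   meaningful for Im z > 0 and trace-normed H. *)
definition weyl_coefficient :: "(real \<Rightarrow> real^2^2) \<Rightarrow> real \<Rightarrow> complex \<Rightarrow> complex" where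
  "weyl_coefficient H \<Lambda> z =
     (THE m. \<exists>Y. square_integrable_solution (extend_free \<Lambda> H) z Y \<and> Y 0 = vector [1, m])"

definition schur_transform :: "(real \<Rightarrow> real^2^2) \<Rightarrow> real \<Rightarrow> complex \<Rightarrow> complex" where
  "schur_transform H \<Lambda> z =
     (weyl_coefficient H \<Lambda> z - \<i>) / (weyl_coefficient H \<Lambda> z + \<i>)"

definition X_mat :: "complex \<Rightarrow> real^2^2" where
  "X_mat q = vector [vector [Re q, Im q], vector [Im q, - Re q]]"

(* For bounded q the perturbed Hamiltonian below is trace-normed for all sufficiently
   small real \<tau>, which is all that the derivative at \<tau> = 0 depends on. *)
definition schur_path :: "real \<Rightarrow> complex \<Rightarrow> (real \<Rightarrow> complex) \<Rightarrow> real \<Rightarrow> complex" where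
  "schur_path \<Lambda> z q \<tau> =
     schur_transform (\<lambda>s. free_hamiltonian s + \<tau> *\<^sub>R X_mat (q s)) \<Lambda> z"

definition D_schur_free :: "real \<Rightarrow> complex \<Rightarrow> (real \<Rightarrow> complex) \<Rightarrow> complex" where
  "D_schur_free \<Lambda> z q = vector_derivative (schur_path \<Lambda> z q) (at 0)"

definition block_function :: "real \<Rightarrow> nat \<Rightarrow> complex Matrix.vec \<Rightarrow> real \<Rightarrow> complex" where
  "block_function \<Lambda> N q s =
     (let l = \<Lambda> / real N in
      \<Sum>j<N. vec_index q j * indicator {real j * l ..< (real j + 1) * l} s)"

(* A design x in R^M is a function of which only the values x 1, ..., x M are used.
   Jordan_Normal_Form indices start at 0, so row i (i < M) belongs to the frequency
   x (i + 1); columns are numbered j = 0, ..., N - 1 as blocks are. *)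
definition free_jacobian ::
  "real \<Rightarrow> real \<Rightarrow> nat \<Rightarrow> nat \<Rightarrow> (nat \<Rightarrow> real) \<Rightarrow> complex Matrix.vec \<Rightarrow> complex Matrix.vec" where
  "free_jacobian \<Lambda> \<eta> M N x \<Delta>q =
     Matrix.vec M (\<lambda>i. D_schur_free \<Lambda> (Complex (x (Suc i)) \<eta>) (block_function \<Lambda> N \<Delta>q))"

definition row_factor :: "real \<Rightarrow> real \<Rightarrow> real \<Rightarrow> complex" where
  "row_factor \<eta> l t =
     - 2 * \<i> * sin (Complex t \<eta> * of_real l / 2) * exp (\<i> * of_real (t * l / 2))"

definition D_gamma :: "real \<Rightarrow> real \<Rightarrow> nat \<Rightarrow> (nat \<Rightarrow> real) \<Rightarrow> complex Matrix.mat" where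
  "D_gamma \<eta> l M x = mat_diag M (\<lambda>i. row_factor \<eta> l (x (Suc i)))"

definition F_mat :: "real \<Rightarrow> nat \<Rightarrow> nat \<Rightarrow> (nat \<Rightarrow> real) \<Rightarrow> complex Matrix.mat" where
  "F_mat l M N x =
     Matrix.mat M N (\<lambda>(i, j). exp (\<i> * of_real (x (Suc i) * real j * l)))"

definition D_w :: "real \<Rightarrow> real \<Rightarrow> nat \<Rightarrow> complex Matrix.mat" where
  "D_w \<eta> l N = mat_diag N (\<lambda>j. of_real (exp (- \<eta> * (real j + 1/2) * l)))"

definition vec_norm2 :: "complex Matrix.vec \<Rightarrow> real" where
  "vec_norm2 u = L2_set (\<lambda>i. cmod (vec_index u i)) {..<dim_vec u}"

(* Least singular value of a linear map A on C^n, n >= 1.  The infimum is a minimum, see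
   sigma_min_attained below. *)
definition sigma_min :: "nat \<Rightarrow> (complex Matrix.vec \<Rightarrow> complex Matrix.vec) \<Rightarrow> real" where
  "sigma_min n A = Inf {vec_norm2 (A u) | u. u \<in> carrier_vec n \<and> vec_norm2 u = 1}"

abbreviation sigma_min_mat :: "complex Matrix.mat \<Rightarrow> real" where
  "sigma_min_mat A \<equiv> sigma_min (dim_col A) (\<lambda>u. A *\<^sub>v u)"

definition half_shifted_design :: "nat \<Rightarrow> real \<Rightarrow> nat \<Rightarrow> real" where
  "half_shifted_design M l k = 2 * pi * (real k - 1/2) / (real M * l)"

definition equispaced_design :: "nat \<Rightarrow> real \<Rightarrow> real \<Rightarrow> nat \<Rightarrow> real" where
  "equispaced_design M l \<alpha> k = 2 * pi * (real k - 1) / (real M * l) + 2 * \<alpha> / l"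

lemma trace_normed_block:
  assumes q: "\<And>s. cmod (q s) \<le> 1/2" and qm: "q \<in> borel_measurable borel"
  shows "trace_normed_hamiltonian \<Lambda> (\<lambda>s. free_hamiltonian s + X_mat (q s))"
proof -
  have X: "X_mat w = (\<chi> i j. if i = 1 then (if j = 1 then Re w else Im w)
                              else (if j = 1 then Im w else - Re w))" for w
    by (simp add: X_mat_def Finite_Cartesian_Product.vec_eq_iff forall_2)
  have "continuous_on UNIV (\<lambda>w. if i = 1 then (if j = 1 then Re w else Im w)
                                  else (if j = 1 then Im w else - Re w))" for i j :: 2
    by (cases "i = 1"; cases "j = 1") (simp_all add: continuous_on_Re continuous_on_Im continuous_on_minus)
  then have "continuous_on UNIV X_mat"
    unfolding X by (intro continuous_on_vec_lambda)
  then have Xm: "X_mat \<in> borel_measurable borel"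
    by (rule borel_measurable_continuous_onI)
  have m: "(\<lambda>s. free_hamiltonian s + X_mat (q s)) \<in> borel_measurable borel"
    unfolding free_hamiltonian_def
    by (intro borel_measurable_add borel_measurable_const measurable_compose[OF qm Xm])
  then have m': "(\<lambda>s. free_hamiltonian s + X_mat (q s)) \<in> borel_measurable (lebesgue_on {0..\<Lambda>})"
    by (intro measurable_restrict_space1 measurable_completion) simp
  have psd: "0 \<le> inner v ((free_hamiltonian s + X_mat (q s)) *v v)" for s and v :: "real^2"
  proof -
    define a b where "a = vec_nth v 1" and "b = vec_nth v 2"
    have "\<bar>Re (q s * (cnj (Complex a b))\<^sup>2)\<bar> \<le> cmod (q s) * (cmod (Complex a b))\<^sup>2"
      by (metis abs_Re_le_cmod complex_mod_cnj norm_mult norm_power)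
    also have "\<dots> \<le> 1/2 * (cmod (Complex a b))\<^sup>2"
      by (intro mult_right_mono q) auto
    also have "\<dots> = 1/2 * (a\<^sup>2 + b\<^sup>2)"
      by (simp add: cmod_power2)
    finally have "\<bar>Re (q s) * (a\<^sup>2 - b\<^sup>2) + 2 * Im (q s) * (a * b)\<bar> \<le> 1/2 * (a\<^sup>2 + b\<^sup>2)"
      by (simp add: power2_eq_square algebra_simps)
    moreover have "inner v ((free_hamiltonian s + X_mat (q s)) *v v) =
        1/2 * (a\<^sup>2 + b\<^sup>2) + (Re (q s) * (a\<^sup>2 - b\<^sup>2) + 2 * Im (q s) * (a * b))"
      by (simp add: inner_vec_def sum_2 matrix_vector_mult_def free_hamiltonian_def X
          Finite_Cartesian_Product.mat_def a_def b_def power2_eq_square algebra_simps)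
    ultimately show ?thesis by linarith
  qed
  have sym: "transpose (free_hamiltonian s + X_mat (q s)) = free_hamiltonian s + X_mat (q s)"
    and tr: "trace (free_hamiltonian s + X_mat (q s)) = 1" for s
    by (simp_all add: Finite_Cartesian_Product.vec_eq_iff forall_2 transpose_def
        trace_def sum_2 free_hamiltonian_def X Finite_Cartesian_Product.mat_def)
  show ?thesis
    unfolding trace_normed_hamiltonian_def using m' psd sym tr by simp
qed

lemma sigma_min_attained:
  assumes A: "A \<in> carrier_mat m n" and n: "1 \<le> n"
  shows "\<exists>u\<in>carrier_vec n. vec_norm2 u = 1 \<and> sigma_min_mat A = vec_norm2 (A *\<^sub>v u)"
proof -
  define nv where "nv f k = L2_set (\<lambda>i. cmod (f i)) {..<k}" for f :: "nat \<Rightarrow> complex" and k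
  define B where "B = PiE UNIV (\<lambda>i. if i < n then cball (0::complex) 1 else {0})"
  define S where "S = B \<inter> {f. nv f n = 1}"
  define g where "g f = vec_norm2 (A *\<^sub>v Matrix.vec n f)" for f
  have cnv: "continuous_on UNIV (\<lambda>f. nv f k)" for k
    unfolding nv_def L2_set_def
    by (intro continuous_intros continuous_on_product_coordinates)
  have "compactin (product_topology (\<lambda>i::nat. euclidean) UNIV) B"
    unfolding B_def by (subst compactin_PiE) auto
  then have cB: "compact B"
    by (simp add: euclidean_product_topology)
  have "closed {f. nv f n = 1}"
    by (intro closed_Collect_eq cnv continuous_on_const)
  with cB have cS: "compact S"
    unfolding S_def by (rule compact_Int_closed)
  have geq: "g f = L2_set (\<lambda>i. cmod (\<Sum>j<n. A $$ (i, j) * f j)) {..<m}" for f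
    using A unfolding g_def vec_norm2_def
    by (auto intro!: L2_set_cong simp: scalar_prod_def row_def atLeast0LessThan)
  have "continuous_on UNIV g"
    unfolding geq L2_set_def
    by (intro continuous_intros continuous_on_product_coordinates)
  then have cg: "continuous_on S g"
    by (rule continuous_on_subset) simp
  have inS: "(\<lambda>i. if i < n then vec_index u i else 0) \<in> S"
    if u: "u \<in> carrier_vec n" "vec_norm2 u = 1" for u
  proof -
    have "cmod (vec_index u i) \<le> 1" if "i < n" for i
      using member_le_L2_set[of "{..<n}" i "\<lambda>i. cmod (vec_index u i)"] u that
      by (simp add: vec_norm2_def)
    moreover have "nv (\<lambda>i. if i < n then vec_index u i else 0) n = 1"
      using u by (simp add: nv_def vec_norm2_def L2_set_def)
    ultimately show ?thesis
      by (auto simp: S_def B_def)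
  qed
  have gu: "g (\<lambda>i. if i < n then vec_index u i else 0) = vec_norm2 (A *\<^sub>v u)"
    if "u \<in> carrier_vec n" for u
    unfolding g_def using that
    by (intro arg_cong[where f = "\<lambda>u. vec_norm2 (A *\<^sub>v u)"] eq_vecI) auto
  have "(\<Sum>i<n. (cmod (if i = 0 then 1 else 0))\<^sup>2) = (\<Sum>i<n. if i = 0 then 1 else 0)"
    by (rule sum.cong) auto
  then have "vec_norm2 (unit_vec n 0) = 1"
    using n by (simp add: vec_norm2_def L2_set_def unit_vec_def)
  then have "S \<noteq> {}"
    using inS[of "unit_vec n 0"] by auto
  then obtain f where f: "f \<in> S" "\<And>h. h \<in> S \<Longrightarrow> g f \<le> g h"
    using continuous_attains_inf[OF cS _ cg] by blast
  define u where "u = Matrix.vec n f"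
  have u: "u \<in> carrier_vec n" "vec_norm2 u = 1"
    using f(1) by (auto simp: u_def S_def nv_def vec_norm2_def L2_set_def)
  have "Inf {vec_norm2 (A *\<^sub>v u) | u. u \<in> carrier_vec n \<and> vec_norm2 u = 1} = vec_norm2 (A *\<^sub>v u)"
  proof (rule cInf_eq_minimum)
    show "vec_norm2 (A *\<^sub>v u) \<in> {vec_norm2 (A *\<^sub>v u) | u. u \<in> carrier_vec n \<and> vec_norm2 u = 1}"
      using u by blast
    show "vec_norm2 (A *\<^sub>v u) \<le> r"
      if "r \<in> {vec_norm2 (A *\<^sub>v u) | u. u \<in> carrier_vec n \<and> vec_norm2 u = 1}" for r
      using that f(2)[OF inS] gu unfolding u_def g_def[symmetric] by force
  qed
  then show ?thesis
    using A u unfolding sigma_min_def by auto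
qed

end

(* Writing Y = a (1, i) + b (1, -i) diagonalises J.  For H = I/2 + X_p the canonical system becomes
   a' = (iz/2) a + iz cnj(p) b,  b' = -(iz/2) b - iz p a,  and the Schur transform of the Weyl
   coefficient is -b(0)/a(0) for the solution with b = 0 on the free tail, which is the
   square-integrable one.  For p = \<tau> q with q piecewise constant this solution is obtained explicitly,
   block by block from the right, and it has the form b = \<tau> G with a and G continuous in \<tau>; hence
   the derivative at \<tau> = 0 is -G/a there, which is the sum of the terms
   q_j (1 - e^{izl}) e^{izjl}.  Uniqueness of the Weyl coefficient follows from the constancy of the
   Wronskian: against a bounded solution, a nonzero Wronskian keeps the energy density away from 0
   on the tail.

   For the singular values, |sin(u + iv)|^2 = sin^2 u + sinh^2 v gives the row factors, the last unit
   vector gives the upper bound, and for equispaced designs the discrete orthogonality of roots of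
   unity makes F / sqrt M an isometry. *)

theory Submission
  imports Defs
begin

section \<open>The canonical system in scalar form\<close>

text \<open>The Weyl coefficient is a \<open>THE\<close> value, so nothing can be differentiated
  before a closed form is known for all small \<tau>, each with its own existence and uniqueness.
  Solving from the right provides it: the free tail fixes the square-integrable direction b = 0, and
  each block acts on it by an explicit matrix exponential. Its rate must not vanish, which is
  ensured by |\<tau> q| < 1/2, that is, by definiteness of the perturbed Hamiltonian. On the way b
  picks up q at first order, whereas cnj q acts on a only through b, hence at second order; this is
  why a derivative in real \<tau> is complex-linear in q.

  The bounds (2) and (3) share their exponential because both come from the last block, whose weight
  is the smallest. The extremal shift is a covering fact: sin^2 has period \<pi>, the phases form a
  grid of step \<pi>/M modulo \<pi>, and such a grid stays farthest from the zeros of the sine when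
  these lie midway between grid points.\<close>

abbreviation perturbed :: "(real \<Rightarrow> complex) \<Rightarrow> real \<Rightarrow> real^2^2" where
  "perturbed p s \<equiv> free_hamiltonian s + X_mat (p s)"

lemma perturbed_mult:
  "vec_nth (z *s (map_matrix complex_of_real (perturbed p s) *v y)) 1 =
     z * ((1/2 + of_real (Re (p s))) * vec_nth y 1 + of_real (Im (p s)) * vec_nth y 2)"
  "vec_nth (z *s (map_matrix complex_of_real (perturbed p s) *v y)) 2 =
     z * (of_real (Im (p s)) * vec_nth y 1 + (1/2 - of_real (Re (p s))) * vec_nth y 2)"
  by (simp_all add: matrix_vector_mult_def sum_2 map_matrix_def free_hamiltonian_def X_mat_def
      Finite_Cartesian_Product.mat_def)

lemma J_mat_mult:
  "vec_nth (J_mat *v y) 1 = - vec_nth y 2" "vec_nth (J_mat *v y) 2 = vec_nth y 1"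
  by (simp_all add: matrix_vector_mult_def sum_2 J_mat_def)

lemma bounded_linear_axis: "bounded_linear (axis k :: complex \<Rightarrow> complex^'n)"
  by (auto simp: linear_conv_bounded_linear[symmetric] axis_def Finite_Cartesian_Product.vec_eq_iff intro!: linearI)

lemma vec_eq_axis_2: "(y :: complex^2) = axis 1 (vec_nth y 1) + axis 2 (vec_nth y 2)"
  by (simp add: Finite_Cartesian_Product.vec_eq_iff forall_2 axis_def)

lemma absolutely_integrable_vec_2_iff:
  fixes f :: "real \<Rightarrow> complex^2"
  shows "f absolutely_integrable_on S \<longleftrightarrow>
    (\<lambda>s. vec_nth (f s) 1) absolutely_integrable_on S \<and> (\<lambda>s. vec_nth (f s) 2) absolutely_integrable_on S"
proof
  assume "f absolutely_integrable_on S"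
  then have "(\<lambda>s. vec_nth (f s) k) absolutely_integrable_on S" for k
    using absolutely_integrable_linear[OF _ bounded_linear_vec_nth] by (auto simp: o_def)
  then show "(\<lambda>s. vec_nth (f s) 1) absolutely_integrable_on S \<and> (\<lambda>s. vec_nth (f s) 2) absolutely_integrable_on S"
    by blast
next
  assume *: "(\<lambda>s. vec_nth (f s) 1) absolutely_integrable_on S \<and> (\<lambda>s. vec_nth (f s) 2) absolutely_integrable_on S"
  then have "(\<lambda>s. axis k (vec_nth (f s) k) :: complex^2) absolutely_integrable_on S" if "k = 1 \<or> k = 2" for k
    using absolutely_integrable_linear[OF _ bounded_linear_axis] that by (auto simp: o_def)
  then have "(\<lambda>s. axis 1 (vec_nth (f s) 1) + axis 2 (vec_nth (f s) 2) :: complex^2) absolutely_integrable_on S"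
    by (intro set_integral_add(1)) auto
  then show "f absolutely_integrable_on S"
    by (simp flip: vec_eq_axis_2)
qed

lemma integral_vec_nth:
  fixes f :: "real \<Rightarrow> complex^'n"
  assumes "f integrable_on S"
  shows "vec_nth (integral S f) k = integral S (\<lambda>s. vec_nth (f s) k)"
  using integral_linear[OF assms bounded_linear_vec_nth[of k]] by (simp add: o_def)

text \<open>J exchanges the components: the first row of z H Y drives the second component of Y,
  with a minus sign, and the second row drives the first.\<close>

lemma canonical_solution_perturbed_iff:
  fixes p Y z
  defines "f1 \<equiv> \<lambda>s. z * ((1/2 + of_real (Re (p s))) * vec_nth (Y s) 1 + of_real (Im (p s)) * vec_nth (Y s) 2)"
    and "f2 \<equiv> \<lambda>s. z * (of_real (Im (p s)) * vec_nth (Y s) 1 + (1/2 - of_real (Re (p s))) * vec_nth (Y s) 2)"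
  shows "canonical_solution (perturbed p) z Y \<longleftrightarrow>
    (\<forall>t\<ge>0. f1 absolutely_integrable_on {0..t} \<and> f2 absolutely_integrable_on {0..t} \<and>
       vec_nth (Y t) 1 = vec_nth (Y 0) 1 + integral {0..t} f2 \<and>
       vec_nth (Y t) 2 = vec_nth (Y 0) 2 - integral {0..t} f1)"
proof -
  define F where "F s = z *s (map_matrix complex_of_real (perturbed p s) *v Y s)" for s
  have F: "(\<lambda>s. vec_nth (F s) 1) = f1" "(\<lambda>s. vec_nth (F s) 2) = f2"
    unfolding F_def f1_def f2_def by (simp_all only: perturbed_mult)
  have "(F absolutely_integrable_on {0..t} \<and> J_mat *v (Y t - Y 0) = integral {0..t} F) \<longleftrightarrow>
    (f1 absolutely_integrable_on {0..t} \<and> f2 absolutely_integrable_on {0..t} \<and>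
       vec_nth (Y t) 1 = vec_nth (Y 0) 1 + integral {0..t} f2 \<and>
       vec_nth (Y t) 2 = vec_nth (Y 0) 2 - integral {0..t} f1)" for t
  proof -
    have "vec_nth (integral {0..t} F) 1 = integral {0..t} f1"
         "vec_nth (integral {0..t} F) 2 = integral {0..t} f2"
      if "F absolutely_integrable_on {0..t}"
      using that F by (simp_all add: integral_vec_nth set_lebesgue_integral_eq_integral)
    then show ?thesis
      unfolding absolutely_integrable_vec_2_iff[where f = F] F Finite_Cartesian_Product.vec_eq_iff[of "J_mat *v _"] forall_2 J_mat_mult
      by (auto simp: algebra_simps)
  qed
  then show ?thesis
    unfolding canonical_solution_def F_def by blast
qed

lemma integral_has_vector_derivative_at:
  fixes f :: "real \<Rightarrow> complex"
  assumes f: "\<And>t. f integrable_on {0..t}" and "0 < t" "isCont f t"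
  shows "((\<lambda>u. integral {0..u} f) has_vector_derivative f t) (at t)"
proof -
  have "((\<lambda>u. integral {0..u} f) has_vector_derivative f t) (at t within ({0..t+1} - {}))"
    using assms by (intro integral_has_vector_derivative_continuous_at)
      (auto intro: continuous_at_imp_continuous_at_within)
  moreover have "at t within {0..t+1} = at t"
    using \<open>0 < t\<close> by (intro at_within_interior) auto
  ultimately show ?thesis by simp
qed

text \<open>\<open>K\<close> will hold the block ends, where \<open>p\<close> jumps; off them the
  Caratheodory equation becomes a classical one.\<close>

definition solves_off :: "real set \<Rightarrow> (real \<Rightarrow> complex) \<Rightarrow> complex \<Rightarrow> (real \<Rightarrow> complex) \<Rightarrow> (real \<Rightarrow> complex) \<Rightarrow> bool" where
  "solves_off K p z y1 y2 \<longleftrightarrow> (\<forall>t. 0 < t \<longrightarrow> t \<notin> K \<longrightarrow>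
     (y1 has_vector_derivative
        z * (of_real (Im (p t)) * y1 t + (1/2 - of_real (Re (p t))) * y2 t)) (at t) \<and>
     (y2 has_vector_derivative
        - z * ((1/2 + of_real (Re (p t))) * y1 t + of_real (Im (p t)) * y2 t)) (at t))"

text \<open>This serves the unknown competitor in the uniqueness argument. As an indefinite
  integral, \<open>Y\<close> is continuous, so the integrand is continuous wherever \<open>p\<close>
  is, and the integral equation can be differentiated there.\<close>

lemma canonical_solution_solves_off:
  assumes sol: "canonical_solution (perturbed p) z Y" and p: "\<And>t. 0 < t \<Longrightarrow> t \<notin> K \<Longrightarrow> isCont p t"
  shows "solves_off K p z (\<lambda>t. vec_nth (Y t) 1) (\<lambda>t. vec_nth (Y t) 2)"
    and "continuous_on {0..} (\<lambda>t. vec_nth (Y t) 1)" "continuous_on {0..} (\<lambda>t. vec_nth (Y t) 2)"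
proof -
  define f1 where "f1 s = z * ((1/2 + of_real (Re (p s))) * vec_nth (Y s) 1 + of_real (Im (p s)) * vec_nth (Y s) 2)" for s
  define f2 where "f2 s = z * (of_real (Im (p s)) * vec_nth (Y s) 1 + (1/2 - of_real (Re (p s))) * vec_nth (Y s) 2)" for s
  note * = canonical_solution_perturbed_iff[THEN iffD1, OF sol, folded f1_def f2_def, rule_format]
  have int: "f1 integrable_on {0..t}" "f2 integrable_on {0..t}" for t
  proof -
    have "f1 integrable_on {0..t} \<and> f2 integrable_on {0..t}"
    proof (cases "0 \<le> t")
      case True
      then show ?thesis using *[of t] set_lebesgue_integral_eq_integral(1) by blast
    qed (simp add: integrable_on_empty)
    then show "f1 integrable_on {0..t}" "f2 integrable_on {0..t}" by auto
  qed
  have Y: "vec_nth (Y t) 1 = vec_nth (Y 0) 1 + integral {0..t} f2"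
    "vec_nth (Y t) 2 = vec_nth (Y 0) 2 - integral {0..t} f1" if "0 \<le> t" for t
    using *[OF that] by blast+
  have cont: "continuous_on {0..} (\<lambda>t. integral {0..t} f)" if "\<And>t. f integrable_on {0..t}" for f :: "real \<Rightarrow> complex"
  proof -
    have "continuous (at t within {0..}) (\<lambda>t. integral {0..t} f)" if "0 \<le> t" for t
    proof -
      have "continuous (at t within {0..t+1}) (\<lambda>t. integral {0..t} f)"
        using indefinite_integral_continuous_1[OF \<open>\<And>t. f integrable_on {0..t}\<close>[of "t+1"]] that
        by (auto simp: continuous_on_eq_continuous_within)
      moreover have "at t within {0..t+1} = at t within {0..}"
        by (rule at_within_nhd[of _ "{t-1<..<t+1}"]) (use that in auto)
      ultimately show ?thesis by simp
    qed
    then show ?thesis by (auto simp: continuous_on_eq_continuous_within)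
  qed
  show c1: "continuous_on {0..} (\<lambda>t. vec_nth (Y t) 1)"
    using int by (subst continuous_on_cong[OF refl Y(1)]) (auto intro!: continuous_intros cont)
  show c2: "continuous_on {0..} (\<lambda>t. vec_nth (Y t) 2)"
    using int by (subst continuous_on_cong[OF refl Y(2)]) (auto intro!: continuous_intros cont)
  show "solves_off K p z (\<lambda>t. vec_nth (Y t) 1) (\<lambda>t. vec_nth (Y t) 2)"
    unfolding solves_off_def
  proof (intro allI impI conjI)
    fix t :: real assume t: "0 < t" "t \<notin> K"
    have ic: "isCont (\<lambda>t. vec_nth (Y t) 1) t" "isCont (\<lambda>t. vec_nth (Y t) 2) t"
      using c1 c2 t by (auto intro!: continuous_on_interior[of "{0..}"])
    have f: "isCont f1 t" "isCont f2 t"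
      unfolding f1_def f2_def using p[OF t] ic by (auto intro!: continuous_intros)
    have "((\<lambda>u. vec_nth (Y 0) 1 + integral {0..u} f2) has_vector_derivative f2 t) (at t)"
      using integral_has_vector_derivative_at[of f2 t] int t f
      by (auto intro!: derivative_eq_intros)
    then show "((\<lambda>t. vec_nth (Y t) 1) has_vector_derivative z * (of_real (Im (p t)) * vec_nth (Y t) 1 + (1/2 - of_real (Re (p t))) * vec_nth (Y t) 2)) (at t)"
      unfolding f2_def[symmetric]
      by (rule has_vector_derivative_transform_within_open[of _ _ _ "{0<..}"]) (use t in \<open>auto simp flip: Y\<close>)
    have "((\<lambda>u. vec_nth (Y 0) 2 - integral {0..u} f1) has_vector_derivative - f1 t) (at t)"
      using integral_has_vector_derivative_at[of f1 t] int t f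
      by (auto intro!: derivative_eq_intros)
    then have "((\<lambda>t. vec_nth (Y t) 2) has_vector_derivative - f1 t) (at t)"
      by (rule has_vector_derivative_transform_within_open[of _ _ _ "{0<..}"]) (use t in \<open>auto simp flip: Y\<close>)
    then show "((\<lambda>t. vec_nth (Y t) 2) has_vector_derivative - z * ((1/2 + of_real (Re (p t))) * vec_nth (Y t) 1 + of_real (Im (p t)) * vec_nth (Y t) 2)) (at t)"
      by (simp add: f1_def)
  qed
qed

lemma borel_measurable_lebesgue_on:
  "f \<in> borel_measurable borel \<Longrightarrow> f \<in> borel_measurable (lebesgue_on S)"
  by (intro measurable_restrict_space1 measurable_completion) simp

text \<open>The fundamental theorem of calculus tolerates finitely many exceptional points for
  continuous functions; a continuous majorant built from the bound on \<open>p\<close> gives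
  absolute integrability.\<close>

lemma solves_off_canonical_solution:
  assumes sol: "solves_off K p z y1 y2" and K: "finite K"
    and y: "continuous_on UNIV y1" "continuous_on UNIV y2"
    and p: "p \<in> borel_measurable borel" "\<And>s. cmod (p s) \<le> B"
  shows "canonical_solution (perturbed p) z (\<lambda>s. vector [y1 s, y2 s])"
proof -
  define f1 where "f1 s = z * ((1/2 + of_real (Re (p s))) * y1 s + of_real (Im (p s)) * y2 s)" for s
  define f2 where "f2 s = z * (of_real (Im (p s)) * y1 s + (1/2 - of_real (Re (p s))) * y2 s)" for s
  have [measurable]: "y1 \<in> borel_measurable borel" "y2 \<in> borel_measurable borel" "p \<in> borel_measurable borel"
    using y p borel_measurable_continuous_onI by auto
  have ReIm: "\<bar>Re (p s)\<bar> \<le> B" "\<bar>Im (p s)\<bar> \<le> B" for s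
    using p(2)[of s] abs_Re_le_cmod[of "p s"] abs_Im_le_cmod[of "p s"] by linarith+
  have fb: "cmod (f1 s) \<le> cmod z * ((1/2 + B) * cmod (y1 s) + (1/2 + B) * cmod (y2 s))"
    "cmod (f2 s) \<le> cmod z * ((1/2 + B) * cmod (y1 s) + (1/2 + B) * cmod (y2 s))" for s
  proof -
    have n: "cmod (1/2 + of_real (Re (p s))) \<le> 1/2 + B" "cmod (1/2 - of_real (Re (p s))) \<le> 1/2 + B"
      "cmod (of_real (Im (p s))) \<le> 1/2 + B"
      using ReIm[of s] norm_triangle_ineq[of "1/2::complex" "of_real (Re (p s))"]
        norm_triangle_ineq4[of "1/2::complex" "of_real (Re (p s))"] by auto
    show "cmod (f1 s) \<le> cmod z * ((1/2 + B) * cmod (y1 s) + (1/2 + B) * cmod (y2 s))"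
      unfolding f1_def norm_mult
      by (intro mult_left_mono order_trans[OF norm_triangle_ineq] add_mono)
        (auto simp: norm_mult intro!: mult_right_mono n[unfolded norm_of_real])
    show "cmod (f2 s) \<le> cmod z * ((1/2 + B) * cmod (y1 s) + (1/2 + B) * cmod (y2 s))"
      unfolding f2_def norm_mult
      by (intro mult_left_mono order_trans[OF norm_triangle_ineq] add_mono)
        (auto simp: norm_mult intro!: mult_right_mono n[unfolded norm_of_real])
  qed
  have ai: "f1 absolutely_integrable_on {0..t}" "f2 absolutely_integrable_on {0..t}" for t
  proof -
    have g: "(\<lambda>s. cmod z * ((1/2 + B) * cmod (y1 s) + (1/2 + B) * cmod (y2 s))) integrable_on {0..t}"
      by (intro integrable_continuous_real continuous_intros) (use y continuous_on_subset in auto)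
    have "f1 \<in> borel_measurable borel" "f2 \<in> borel_measurable borel"
      unfolding f1_def f2_def by measurable
    then show "f1 absolutely_integrable_on {0..t}" "f2 absolutely_integrable_on {0..t}"
      using g fb by (auto intro!: measurable_bounded_by_integrable_imp_absolutely_integrable borel_measurable_lebesgue_on)
  qed
  have FTC: "(f2 has_integral (y1 t - y1 0)) {0..t}" "((\<lambda>s. - f1 s) has_integral (y2 t - y2 0)) {0..t}" if "0 \<le> t" for t
    using sol that K y unfolding solves_off_def
    by (auto intro!: fundamental_theorem_of_calculus_interior_strong[of K] continuous_on_subset[of UNIV] simp: f1_def f2_def)
  then have "y1 t = y1 0 + integral {0..t} f2" "y2 t = y2 0 - integral {0..t} f1" if "0 \<le> t" for t
    using integral_unique[OF FTC(1)[OF that]] integral_unique[OF FTC(2)[OF that]]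
    by (simp_all add: algebra_simps)
  then have "\<forall>t\<ge>0. f1 absolutely_integrable_on {0..t} \<and> f2 absolutely_integrable_on {0..t} \<and>
      y1 t = y1 0 + integral {0..t} f2 \<and> y2 t = y2 0 - integral {0..t} f1"
    using ai by blast
  then show ?thesis
    unfolding canonical_solution_perturbed_iff f1_def f2_def vector_2 .
qed

text \<open>The coefficient matrix is trace-free because H is symmetric, so the Wronskian has
  derivative 0 off \<open>K\<close>.\<close>

lemma solves_off_wronskian:
  assumes "solves_off K p z y1 y2" "solves_off K p z u1 u2" "finite K" "0 \<le> t"
    and "continuous_on {0..} y1" "continuous_on {0..} y2" "continuous_on {0..} u1" "continuous_on {0..} u2"
  shows "y1 t * u2 t - y2 t * u1 t = y1 0 * u2 0 - y2 0 * u1 0"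
proof -
  have "((\<lambda>s. y1 s * u2 s - y2 s * u1 s) has_vector_derivative 0) (at s)" if "0 < s" "s \<notin> K" for s
    using assms(1,2) that unfolding solves_off_def
    by (auto intro!: derivative_eq_intros simp: algebra_simps)
  then have "((\<lambda>s. 0) has_integral (y1 t * u2 t - y2 t * u1 t - (y1 0 * u2 0 - y2 0 * u1 0))) {0..t}"
    using assms by (intro fundamental_theorem_of_calculus_interior_strong[of K] continuous_intros)
      (auto elim: continuous_on_subset)
  then show ?thesis
    using has_integral_0 has_integral_unique by fastforce
qed

section \<open>Diagonal coordinates and explicit solutions on blocks\<close>

text \<open>
  The coefficient matrix is trace-free with square \<open>\<rho>\<^sup>2\<close>, so its exponential is
  \<open>cosh (\<rho> t) + sinh (\<rho> t) / \<rho>\<close> times the matrix.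
\<close>
lemma constant_coefficient_solution:
  fixes z c \<alpha> \<beta> \<rho> :: complex and t1 :: real
  assumes \<rho>: "\<rho> \<noteq> 0" "\<rho>\<^sup>2 = z\<^sup>2 * (c * cnj c - 1/4)"
  defines "A \<equiv> \<lambda>t. cosh (\<rho> * of_real (t - t1)) * \<alpha> + sinh (\<rho> * of_real (t - t1)) / \<rho> * (\<i> * z / 2 * \<alpha> + \<i> * z * cnj c * \<beta>)"
    and "B \<equiv> \<lambda>t. cosh (\<rho> * of_real (t - t1)) * \<beta> + sinh (\<rho> * of_real (t - t1)) / \<rho> * (- (\<i> * z / 2 * \<beta>) - \<i> * z * c * \<alpha>)"
  shows "(A has_vector_derivative \<i> * z / 2 * A t + \<i> * z * cnj c * B t) (at t)"
    and "(B has_vector_derivative - (\<i> * z / 2 * B t) - \<i> * z * c * A t) (at t)"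
proof -
  have *: "((\<lambda>t. cosh (\<rho> * of_real (t - t1)) * u + sinh (\<rho> * of_real (t - t1)) / \<rho> * v) has_vector_derivative
      sinh (\<rho> * of_real (t - t1)) * \<rho> * u + cosh (\<rho> * of_real (t - t1)) * v) (at t)" for u v
  proof -
    have "((\<lambda>w. cosh (\<rho> * (w - of_real t1)) * u + sinh (\<rho> * (w - of_real t1)) / \<rho> * v) has_field_derivative
        sinh (\<rho> * (of_real t - of_real t1)) * \<rho> * u + cosh (\<rho> * (of_real t - of_real t1)) * v) (at (of_real t))"
      using \<rho>(1) by (auto intro!: derivative_eq_intros)
    from has_vector_derivative_real_field[OF this] show ?thesis by (simp add: o_def)
  qed
  \<comment> \<open>Only the square of \<open>\<rho>\<close> is known, so a single factor
    \<open>\<rho>\<close> is rewritten as its square over \<open>\<rho>\<close>.\<close>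
  have r: "\<rho> * u = \<rho>\<^sup>2 * u / \<rho>" for u
    using \<rho>(1) by (simp add: power2_eq_square)
  show "(A has_vector_derivative \<i> * z / 2 * A t + \<i> * z * cnj c * B t) (at t)"
    unfolding A_def B_def
  proof (rule has_vector_derivative_eq_rhs[OF *])
    show "sinh (\<rho> * of_real (t - t1)) * \<rho> * \<alpha> + cosh (\<rho> * of_real (t - t1)) * (\<i> * z / 2 * \<alpha> + \<i> * z * cnj c * \<beta>) =
      \<i> * z / 2 * (cosh (\<rho> * of_real (t - t1)) * \<alpha> + sinh (\<rho> * of_real (t - t1)) / \<rho> * (\<i> * z / 2 * \<alpha> + \<i> * z * cnj c * \<beta>)) +
      \<i> * z * cnj c * (cosh (\<rho> * of_real (t - t1)) * \<beta> + sinh (\<rho> * of_real (t - t1)) / \<rho> * (- (\<i> * z / 2 * \<beta>) - \<i> * z * c * \<alpha>))"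
      unfolding mult.assoc[of _ \<rho>] r[of \<alpha>] \<rho>(2)
      by (simp add: algebra_simps add_divide_distrib diff_divide_distrib power2_eq_square)
  qed
  show "(B has_vector_derivative - (\<i> * z / 2 * B t) - \<i> * z * c * A t) (at t)"
    unfolding A_def B_def
  proof (rule has_vector_derivative_eq_rhs[OF *])
    show "sinh (\<rho> * of_real (t - t1)) * \<rho> * \<beta> + cosh (\<rho> * of_real (t - t1)) * (- (\<i> * z / 2 * \<beta>) - \<i> * z * c * \<alpha>) =
      - (\<i> * z / 2 * (cosh (\<rho> * of_real (t - t1)) * \<beta> + sinh (\<rho> * of_real (t - t1)) / \<rho> * (- (\<i> * z / 2 * \<beta>) - \<i> * z * c * \<alpha>))) -
      \<i> * z * c * (cosh (\<rho> * of_real (t - t1)) * \<alpha> + sinh (\<rho> * of_real (t - t1)) / \<rho> * (\<i> * z / 2 * \<alpha> + \<i> * z * cnj c * \<beta>))"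
      unfolding mult.assoc[of _ \<rho>] r[of \<beta>] \<rho>(2)
      by (simp add: algebra_simps add_divide_distrib diff_divide_distrib power2_eq_square)
  qed
qed

text \<open>
  Here \<open>a\<close> and \<open>b\<close> are the coordinates of \<open>Y\<close> with respect to the eigenvectors
  \<open>(1, \<i>)\<close> and \<open>(1, -\<i>)\<close> of \<open>J\<close>, that is, \<open>Y = (a + b, \<i> (a - b))\<close>.
\<close>
definition diag_solves_off :: "real set \<Rightarrow> real \<Rightarrow> (real \<Rightarrow> complex) \<Rightarrow> complex \<Rightarrow> (real \<Rightarrow> complex) \<Rightarrow> (real \<Rightarrow> complex) \<Rightarrow> bool" where
  "diag_solves_off K t0 p z a b \<longleftrightarrow> (\<forall>t. t0 < t \<longrightarrow> t \<notin> K \<longrightarrow>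
     (a has_vector_derivative \<i> * z / 2 * a t + \<i> * z * cnj (p t) * b t) (at t) \<and>
     (b has_vector_derivative - (\<i> * z / 2 * b t) - \<i> * z * p t * a t) (at t))"

text \<open>The free factor \<open>d\<close> later normalises the first component to 1 at the
  origin.\<close>

lemma diag_solves_off_solves_off:
  assumes "diag_solves_off K 0 p z a b"
  shows "solves_off K p z (\<lambda>t. d * (a t + b t)) (\<lambda>t. d * (\<i> * (a t - b t)))"
  unfolding solves_off_def
proof (intro allI impI conjI)
  fix t :: real assume t: "0 < t" "t \<notin> K"
  have a: "(a has_vector_derivative \<i> * z / 2 * a t + \<i> * z * cnj (p t) * b t) (at t)"
    and b: "(b has_vector_derivative - (\<i> * z / 2 * b t) - \<i> * z * p t * a t) (at t)"
    using assms t unfolding diag_solves_off_def by blast+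
  \<comment> \<open>With \<open>p\<close> and \<open>cnj p\<close> expressed through the same real
    and imaginary parts, both sides become polynomials that \<open>algebra_simps\<close> can
    compare.\<close>
  have p: "p t = of_real (Re (p t)) + \<i> * of_real (Im (p t))"
    "cnj (p t) = of_real (Re (p t)) - \<i> * of_real (Im (p t))"
    by (simp_all add: complex_eq_iff)
  show "((\<lambda>t. d * (a t + b t)) has_vector_derivative
      z * (of_real (Im (p t)) * (d * (a t + b t)) + (1/2 - of_real (Re (p t))) * (d * (\<i> * (a t - b t))))) (at t)"
    by (rule derivative_eq_intros a b refl)+
      (subst p(1), subst p(2), simp add: algebra_simps)
  show "((\<lambda>t. d * (\<i> * (a t - b t))) has_vector_derivative
      - z * ((1/2 + of_real (Re (p t))) * (d * (a t + b t)) + of_real (Im (p t)) * (d * (\<i> * (a t - b t))))) (at t)"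
    by (rule derivative_eq_intros a b refl)+
      (subst p(1), subst p(2), simp add: algebra_simps)
qed

text \<open>At the joint no derivative is claimed, as \<open>t1\<close> belongs to \<open>K\<close>;
  away from it the glued function coincides locally with one of its two pieces.\<close>

lemma diag_solves_off_glue:
  assumes AB: "\<And>t. t0 < t \<Longrightarrow> t < t1 \<Longrightarrow> (A has_vector_derivative \<i> * z / 2 * A t + \<i> * z * cnj (p t) * B t) (at t)"
      "\<And>t. t0 < t \<Longrightarrow> t < t1 \<Longrightarrow> (B has_vector_derivative - (\<i> * z / 2 * B t) - \<i> * z * p t * A t) (at t)"
    and ab: "diag_solves_off K t1 p z a b" and "t1 \<in> K"
  shows "diag_solves_off K t0 p z (\<lambda>t. if t \<le> t1 then A t else a t) (\<lambda>t. if t \<le> t1 then B t else b t)"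
  unfolding diag_solves_off_def
proof (intro allI impI)
  fix t assume t: "t0 < t" "t \<notin> K"
  have tr: "((\<lambda>t. if t \<le> t1 then f t else g t) has_vector_derivative d) (at t)"
    if "t < t1 \<longrightarrow> (f has_vector_derivative d) (at t)" "t1 < t \<longrightarrow> (g has_vector_derivative d) (at t)"
    for f g :: "real \<Rightarrow> complex" and d
  proof (cases "t < t1")
    case True
    show ?thesis
      by (rule has_vector_derivative_transform_within_open[of f d t "{..<t1}"]) (use that \<open>t < t1\<close> in auto)
  next
    case False
    then have "t1 < t" using t \<open>t1 \<in> K\<close> by (cases "t = t1") auto
    show ?thesis
      by (rule has_vector_derivative_transform_within_open[of g d t "{t1<..}"]) (use that \<open>t1 < t\<close> in auto)
  qed
  show "((\<lambda>t. if t \<le> t1 then A t else a t) has_vector_derivative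
      \<i> * z / 2 * (if t \<le> t1 then A t else a t) + \<i> * z * cnj (p t) * (if t \<le> t1 then B t else b t)) (at t) \<and>
    ((\<lambda>t. if t \<le> t1 then B t else b t) has_vector_derivative
      - (\<i> * z / 2 * (if t \<le> t1 then B t else b t)) - \<i> * z * p t * (if t \<le> t1 then A t else a t)) (at t)"
    using AB[of t] ab t unfolding diag_solves_off_def by (intro conjI tr) auto
qed

lemma continuous_on_glue:
  fixes A a :: "real \<Rightarrow> complex"
  assumes "continuous_on UNIV A" "continuous_on UNIV a" "A t1 = a t1"
  shows "continuous_on UNIV (\<lambda>t. if t \<le> t1 then A t else a t)"
  using assms by (intro continuous_on_cases_le) (auto intro: continuous_on_subset)

text \<open>
  Factoring \<open>\<tau>\<close> out of \<open>b\<close> makes continuity of \<open>\<alpha>\<close> and \<open>G\<close> at 0 sufficient for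
  differentiating \<open>b / a\<close> there.
\<close>
lemma block_solution:
  fixes Q :: "nat \<Rightarrow> complex" and q :: "real \<Rightarrow> complex" and z :: complex and l R :: real
  assumes z: "z \<noteq> 0" and l: "0 \<le> l" and R: "\<And>j. j < N \<Longrightarrow> cmod (Q j) \<le> R"
    and q: "\<And>j t. j < N \<Longrightarrow> real j * l < t \<Longrightarrow> t < real (Suc j) * l \<Longrightarrow> q t = Q j"
    and q0: "\<And>t. real N * l < t \<Longrightarrow> q t = 0"
    and K: "K = (\<lambda>j. real j * l) ` {..N}"
  defines "E \<equiv> exp (\<i> * z * of_real l / 2)"
  assumes "k \<le> N"
  shows "\<exists>\<alpha> G :: real \<Rightarrow> complex. isCont \<alpha> 0 \<and> isCont G 0 \<and> \<alpha> 0 = 1 / E ^ k \<and>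
    G 0 = - (1 - E\<^sup>2) / E ^ k * (\<Sum>i<k. Q (N - k + i) * E ^ (2 * i)) \<and>
    (\<forall>\<tau>. \<bar>\<tau>\<bar> * R < 1/2 \<longrightarrow> (\<exists>a b. continuous_on UNIV a \<and> continuous_on UNIV b \<and>
       diag_solves_off K (real (N - k) * l) (\<lambda>t. of_real \<tau> * q t) z a b \<and>
       a (real (N - k) * l) = \<alpha> \<tau> \<and> b (real (N - k) * l) = of_real \<tau> * G \<tau> \<and>
       (\<forall>t \<ge> real N * l. a t = exp (\<i> * z * of_real (t - real N * l) / 2) \<and> b t = 0)))"
  using \<open>k \<le> N\<close>
proof (induction k)
  \<comment> \<open>\<open>k\<close> counts the blocks passed from the right. Before the first one
    there is only the free tail, with b = 0 and a a pure exponential.\<close>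
  case 0
  have "((\<lambda>t. exp (\<i> * z * of_real (t - real N * l) / 2)) has_vector_derivative
      \<i> * z / 2 * exp (\<i> * z * of_real (t - real N * l) / 2)) (at t)" for t
  proof -
    have "((\<lambda>w. exp (\<i> * z * (w - of_real (real N * l)) / 2)) has_field_derivative
      \<i> * z / 2 * exp (\<i> * z * (of_real t - of_real (real N * l)) / 2)) (at (of_real t))"
      by (auto intro!: derivative_eq_intros)
    from has_vector_derivative_real_field[OF this] show ?thesis by (simp add: o_def)
  qed
  then have "diag_solves_off K (real N * l) (\<lambda>t. of_real \<tau> * q t) z
      (\<lambda>t. exp (\<i> * z * of_real (t - real N * l) / 2)) (\<lambda>t. 0)" for \<tau>
    unfolding diag_solves_off_def using q0 by simp
  then show ?case
    by (intro exI[of _ "\<lambda>_. 1"] exI[of _ "\<lambda>_. 0"] conjI allI impI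
          exI[of _ "\<lambda>t. exp (\<i> * z * of_real (t - real N * l) / 2)"])
      (auto intro!: continuous_intros)
next
  case (Suc k)
  define j where "j = N - Suc k"
  have j: "j < N" "N - k = Suc j" "N - Suc k = j" using Suc.prems by (auto simp: j_def)
  define c where "c = Q j"
  define t1 where "t1 = real (Suc j) * l"
  obtain \<alpha> G :: "real \<Rightarrow> complex" where IH: "isCont \<alpha> 0" "isCont G 0" "\<alpha> 0 = 1 / E ^ k"
      "G 0 = - (1 - E\<^sup>2) / E ^ k * (\<Sum>i<k. Q (Suc j + i) * E ^ (2 * i))"
    and sol: "\<And>\<tau>. \<bar>\<tau>\<bar> * R < 1/2 \<Longrightarrow> (\<exists>a b. continuous_on UNIV a \<and> continuous_on UNIV b \<and>
       diag_solves_off K t1 (\<lambda>t. of_real \<tau> * q t) z a b \<and>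
       a t1 = \<alpha> \<tau> \<and> b t1 = of_real \<tau> * G \<tau> \<and>
       (\<forall>t \<ge> real N * l. a t = exp (\<i> * z * of_real (t - real N * l) / 2) \<and> b t = 0))"
    using Suc.IH Suc.prems unfolding j t1_def by auto
  \<comment> \<open>The square of this is z^2 (|\<tau> c|^2 - 1/4), as the block solution requires.
    The branch is chosen continuous at \<tau> = 0, with the nonzero value iz/2 there.\<close>
  define \<rho> where "\<rho> \<tau> = \<i> * z / 2 * of_real (sqrt (1 - 4 * (\<tau> * cmod c)\<^sup>2))" for \<tau>
  define C where "C \<tau> = cosh (\<rho> \<tau> * of_real l)" for \<tau>
  define S where "S \<tau> = sinh (\<rho> \<tau> * of_real l) / \<rho> \<tau>" for \<tau>
  \<comment> \<open>These are the values of the block solution at its left end, at distance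
    \<open>- l\<close> from \<open>t1\<close>; the sign comes from sinh being odd. In
    \<open>G'\<close> a common factor \<tau> has been divided out.\<close>
  define \<alpha>' where "\<alpha>' \<tau> = (C \<tau> - S \<tau> * (\<i> * z / 2)) * \<alpha> \<tau> - S \<tau> * (\<i> * z) * of_real (\<tau>\<^sup>2) * cnj c * G \<tau>" for \<tau>
  define G' where "G' \<tau> = (C \<tau> + S \<tau> * (\<i> * z / 2)) * G \<tau> + S \<tau> * (\<i> * z) * c * \<alpha> \<tau>" for \<tau>
  have cont_\<rho>: "isCont \<rho> 0"
    unfolding \<rho>_def by (intro continuous_intros)
  have \<rho>0: "\<rho> 0 = \<i> * z / 2" by (simp add: \<rho>_def)
  have cont_CS: "isCont C 0" "isCont S 0"
    unfolding C_def S_def cosh_field_def sinh_field_def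
    by (intro continuous_intros cont_\<rho> | simp add: \<rho>0 z)+
  \<comment> \<open>At \<tau> = 0 the block is free: going one block to the left multiplies a by 1/E
    and b by E, and E - 1/E is the weight with which the block value enters b.\<close>
  have CS0: "C 0 + S 0 * (\<i> * z / 2) = E" "C 0 - S 0 * (\<i> * z / 2) = 1 / E"
    "S 0 * (\<i> * z) = E - 1 / E"
    using z unfolding C_def S_def \<rho>0 E_def
    by (simp_all add: cosh_field_def sinh_field_def exp_minus field_simps)
  have E0: "E \<noteq> 0" by (simp add: E_def)
  have \<alpha>'0: "\<alpha>' 0 = 1 / E ^ Suc k"
    unfolding \<alpha>'_def CS0 IH by simp
  have G'0: "G' 0 = - (1 - E\<^sup>2) / E ^ Suc k * (\<Sum>i<Suc k. Q (j + i) * E ^ (2 * i))"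
  proof -
    define X where "X = (\<Sum>i<k. Q (Suc j + i) * E ^ (2 * i))"
    have sum: "(\<Sum>i<Suc k. Q (j + i) * E ^ (2 * i)) = c + E\<^sup>2 * X"
      unfolding X_def sum_distrib_left sum.lessThan_Suc_shift
      by (simp add: c_def power2_eq_square mult_ac)
    have G': "G' 0 = E * (- (1 - E\<^sup>2) / E ^ k * X) + (E - 1 / E) * c * (1 / E ^ k)"
      unfolding G'_def CS0 IH X_def by simp
    show ?thesis
      unfolding sum G' using E0 by (simp add: field_simps power2_eq_square)
  qed
  have ex: "\<exists>a b. continuous_on UNIV a \<and> continuous_on UNIV b \<and>
       diag_solves_off K (real j * l) (\<lambda>t. of_real \<tau> * q t) z a b \<and>
       a (real j * l) = \<alpha>' \<tau> \<and> b (real j * l) = of_real \<tau> * G' \<tau> \<and>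
       (\<forall>t \<ge> real N * l. a t = exp (\<i> * z * of_real (t - real N * l) / 2) \<and> b t = 0)"
    if \<tau>: "\<bar>\<tau>\<bar> * R < 1/2" for \<tau>
  proof -
    obtain a b where ab: "continuous_on UNIV a" "continuous_on UNIV b"
       "diag_solves_off K t1 (\<lambda>t. of_real \<tau> * q t) z a b"
       "a t1 = \<alpha> \<tau>" "b t1 = of_real \<tau> * G \<tau>"
       "\<forall>t \<ge> real N * l. a t = exp (\<i> * z * of_real (t - real N * l) / 2) \<and> b t = 0"
      using sol[OF \<tau>] by (elim exE conjE) (rule that)
    \<comment> \<open>The eigenvalues of I/2 + X with parameter \<tau> c are 1/2 plus or minus
      |\<tau> c|. Their positivity is what keeps the square root in \<open>\<rho>\<close> real and
      nonzero.\<close>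
    have "\<bar>\<tau> * cmod c\<bar> \<le> \<bar>\<tau>\<bar> * R"
      unfolding abs_mult using R[OF j(1)] by (simp add: c_def mult_left_mono)
    then have "(2 * (\<tau> * cmod c))\<^sup>2 < 1"
      using \<tau> by (subst abs_square_less_1) simp
    then have lt: "4 * (\<tau> * cmod c)\<^sup>2 < 1"
      by (simp add: power_mult_distrib)
    then have \<rho>: "\<rho> \<tau> \<noteq> 0"
      using z by (simp add: \<rho>_def)
    have sq: "(of_real (sqrt (1 - 4 * (\<tau> * cmod c)\<^sup>2)))\<^sup>2 = (of_real (1 - 4 * (\<tau> * cmod c)\<^sup>2) :: complex)"
      using lt by (simp flip: of_real_power)
    have cc: "(of_real \<tau> * c) * cnj (of_real \<tau> * c) = of_real ((\<tau> * cmod c)\<^sup>2)"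
      unfolding complex_norm_square[symmetric] norm_mult by (simp add: power_mult_distrib)
    have \<rho>2: "(\<rho> \<tau>)\<^sup>2 = z\<^sup>2 * ((of_real \<tau> * c) * cnj (of_real \<tau> * c) - 1/4)"
      unfolding \<rho>_def power_mult_distrib[of "\<i> * z / 2"] sq cc
      by (simp add: power_mult_distrib power_divide algebra_simps)
    define A where "A t = cosh (\<rho> \<tau> * of_real (t - t1)) * \<alpha> \<tau> + sinh (\<rho> \<tau> * of_real (t - t1)) / \<rho> \<tau> *
      (\<i> * z / 2 * \<alpha> \<tau> + \<i> * z * cnj (of_real \<tau> * c) * (of_real \<tau> * G \<tau>))" for t
    define B where "B t = cosh (\<rho> \<tau> * of_real (t - t1)) * (of_real \<tau> * G \<tau>) + sinh (\<rho> \<tau> * of_real (t - t1)) / \<rho> \<tau> *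
      (- (\<i> * z / 2 * (of_real \<tau> * G \<tau>)) - \<i> * z * (of_real \<tau> * c) * \<alpha> \<tau>)" for t
    have AB: "(A has_vector_derivative \<i> * z / 2 * A t + \<i> * z * cnj (of_real \<tau> * c) * B t) (at t)"
      "(B has_vector_derivative - (\<i> * z / 2 * B t) - \<i> * z * (of_real \<tau> * c) * A t) (at t)" for t
      unfolding A_def B_def by (rule constant_coefficient_solution[OF \<rho> \<rho>2])+
    have "isCont A t" "isCont B t" for t
      using AB[of t, THEN has_vector_derivative_continuous] by auto
    then have AB_cont: "continuous_on UNIV A" "continuous_on UNIV B"
      by (simp_all add: continuous_at_imp_continuous_on)
    have AB1: "A t1 = a t1" "B t1 = b t1"
      by (simp_all add: A_def B_def ab)
    have "t1 \<in> K"
      unfolding K t1_def using j by (intro imageI) simp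
    then have "diag_solves_off K (real j * l) (\<lambda>t. of_real \<tau> * q t) z
        (\<lambda>t. if t \<le> t1 then A t else a t) (\<lambda>t. if t \<le> t1 then B t else b t)"
      using AB q[OF j(1)] ab(3) by (intro diag_solves_off_glue) (simp_all add: c_def t1_def)
    moreover have t1: "real j * l \<le> t1" "real j * l - t1 = - l"
      using l by (simp_all add: t1_def algebra_simps)
    then have "A (real j * l) = \<alpha>' \<tau>" "B (real j * l) = of_real \<tau> * G' \<tau>"
      unfolding A_def B_def t1(2) \<alpha>'_def G'_def C_def S_def
      by (simp_all add: algebra_simps power2_eq_square)
    \<comment> \<open>For the last block \<open>t1\<close> is itself the start of the tail; there
      both branches have the same value.\<close>
    moreover have "(if t \<le> t1 then A t else a t) = a t" "(if t \<le> t1 then B t else b t) = b t"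
      if "t \<ge> real N * l" for t
    proof -
      have "t1 \<le> t" unfolding t1_def using that j l mult_right_mono[of "real (Suc j)" "real N" l] by simp
      then show "(if t \<le> t1 then A t else a t) = a t" "(if t \<le> t1 then B t else b t) = b t"
        using AB1 by auto
    qed
    ultimately show ?thesis
      using AB_cont AB1 ab(1,2,6) t1(1)
      by (intro exI[of _ "\<lambda>t. if t \<le> t1 then A t else a t"] exI[of _ "\<lambda>t. if t \<le> t1 then B t else b t"] conjI
          continuous_on_glue) simp_all
  qed
  have cont': "isCont \<alpha>' 0" "isCont G' 0"
    unfolding \<alpha>'_def[abs_def] G'_def[abs_def] by (intro continuous_intros cont_CS IH(1,2))+
  show ?case
    unfolding j
    by (intro exI[of _ \<alpha>'] exI[of _ G'] conjI allI impI cont' \<alpha>'0 G'0 ex)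
qed

section \<open>The Weyl coefficient\<close>

lemma energy_density_perturbed:
  "energy_density (perturbed p) Y s =
     cnj (vec_nth (Y s) 1) * ((1/2 + of_real (Re (p s))) * vec_nth (Y s) 1 + of_real (Im (p s)) * vec_nth (Y s) 2) +
     cnj (vec_nth (Y s) 2) * (of_real (Im (p s)) * vec_nth (Y s) 1 + (1/2 - of_real (Re (p s))) * vec_nth (Y s) 2)"
  using perturbed_mult[where z = 1 and p = p and s = s and y = "Y s"] by (simp add: energy_density_def sum_2)

lemma energy_density_free_tail:
  assumes "p s = 0"
  shows "energy_density (perturbed p) Y s = of_real (((cmod (vec_nth (Y s) 1))\<^sup>2 + (cmod (vec_nth (Y s) 2))\<^sup>2) / 2)"
  unfolding energy_density_perturbed of_real_divide of_real_add complex_norm_square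
  using assms by (simp add: mult_ac add_divide_distrib)

lemma not_absolutely_integrable_bounded_below:
  fixes f :: "real \<Rightarrow> complex"
  assumes f: "f absolutely_integrable_on {0..}" and "0 < \<delta>" "0 \<le> \<Lambda>" and b: "\<And>t. \<Lambda> \<le> t \<Longrightarrow> \<delta> \<le> cmod (f t)"
  shows False
proof -
  have i: "(\<lambda>t. cmod (f t)) integrable_on {0..}"
    using f by (simp add: absolutely_integrable_on_def)
  have "real n * \<delta> \<le> integral {0..} (\<lambda>t. cmod (f t))" for n
  proof -
    have s: "(\<lambda>t. cmod (f t)) integrable_on {\<Lambda>..\<Lambda> + real n}"
      using i by (rule integrable_on_subinterval) (use \<open>0 \<le> \<Lambda>\<close> in auto)
    have "real n * \<delta> = integral {\<Lambda>..\<Lambda> + real n} (\<lambda>t. \<delta>)" by simp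
    also have "\<dots> \<le> integral {\<Lambda>..\<Lambda> + real n} (\<lambda>t. cmod (f t))"
      by (rule integral_le) (use s b in auto)
    also have "\<dots> \<le> integral {0..} (\<lambda>t. cmod (f t))"
      by (rule integral_subset_le) (use s i \<open>0 \<le> \<Lambda>\<close> in auto)
    finally show ?thesis .
  qed
  moreover obtain n where "integral {0..} (\<lambda>t. cmod (f t)) < real n * \<delta>"
    using reals_Archimedean3[OF \<open>0 < \<delta>\<close>] by blast
  ultimately show False by (meson not_le)
qed

text \<open>One exponentially decaying solution settles both halves of \<open>THE\<close>: it is
  square-integrable itself, and its boundedness turns the Wronskian into an obstruction to any other
  initial value.\<close>

lemma weyl_coefficient_eq:
  assumes H: "extend_free \<Lambda> H = perturbed p" and \<Lambda>: "0 \<le> \<Lambda>"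
    and p: "p \<in> borel_measurable borel" "\<And>s. cmod (p s) \<le> B" "\<And>s. \<Lambda> \<le> s \<Longrightarrow> p s = 0"
      "\<And>t. 0 < t \<Longrightarrow> t \<notin> K \<Longrightarrow> isCont p t" and K: "finite K"
    and u: "solves_off K p z u1 u2" "continuous_on UNIV u1" "continuous_on UNIV u2" "u1 0 = 1"
    and decay: "0 < c" "\<And>t. 0 \<le> t \<Longrightarrow> cmod (u1 t) \<le> D * exp (- c * t)" "\<And>t. 0 \<le> t \<Longrightarrow> cmod (u2 t) \<le> D * exp (- c * t)"
  shows "weyl_coefficient H \<Lambda> z = u2 0"
  unfolding weyl_coefficient_def H
proof (rule the_equality)
  define U :: "real \<Rightarrow> complex^2" where "U t = vector [u1 t, u2 t]" for t
  have U: "vec_nth (U t) 1 = u1 t" "vec_nth (U t) 2 = u2 t" for t by (simp_all add: U_def)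
  have "canonical_solution (perturbed p) z U"
    unfolding U_def using solves_off_canonical_solution[OF u(1) K u(2,3) p(1,2)] .
  moreover have "energy_density (perturbed p) U absolutely_integrable_on {0..}"
  proof (rule measurable_bounded_by_integrable_imp_absolutely_integrable)
    have [measurable]: "u1 \<in> borel_measurable borel" "u2 \<in> borel_measurable borel"
        "p \<in> borel_measurable borel" "cnj \<in> borel_measurable borel"
      using u(2,3) p(1) borel_measurable_continuous_onI by (auto intro!: borel_measurable_continuous_onI continuous_intros)
    have "(\<lambda>s. energy_density (perturbed p) U s) \<in> borel_measurable borel"
      unfolding energy_density_perturbed U by measurable
    then show "energy_density (perturbed p) U \<in> borel_measurable (lebesgue_on {0..})"
      by (intro borel_measurable_lebesgue_on) simp
    \<comment> \<open>The energy density has four terms, each with a coefficient at most 1/2 + B and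
      two solution factors at most D e^{-ct}.\<close>
    show "(\<lambda>t. 4 * D\<^sup>2 * (1/2 + B) * exp (- (2 * c) * t)) integrable_on {0..}"
      using has_integral_exp_minus_to_infinity[of "2 * c" 0] \<open>0 < c\<close>
      by (intro integrable_on_mult_right) auto
    fix t :: real assume "t \<in> {0..}"
    then have t: "0 \<le> t" by simp
    define e where "e = D * exp (- c * t)"
    have e: "cmod (u1 t) \<le> e" "cmod (u2 t) \<le> e" "0 \<le> e"
      using decay(2,3)[OF t] order_trans[OF norm_ge_zero decay(2)[OF t]] by (simp_all add: e_def)
    have n: "cmod (1/2 + of_real (Re (p t))) \<le> 1/2 + B" "cmod (1/2 - of_real (Re (p t))) \<le> 1/2 + B"
      "cmod (of_real (Im (p t))) \<le> 1/2 + B"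
      using norm_triangle_ineq[of "1/2::complex" "of_real (Re (p t))"]
        norm_triangle_ineq4[of "1/2::complex" "of_real (Re (p t))"]
        p(2)[of t] abs_Re_le_cmod[of "p t"] abs_Im_le_cmod[of "p t"] by auto
    have "0 \<le> B" using order_trans[OF norm_ge_zero p(2)] .
    have le: "cmod (cnj v * (x1 * u1 t + x2 * u2 t)) \<le> e * ((1/2 + B) * e + (1/2 + B) * e)"
      if "cmod v \<le> e" "cmod x1 \<le> 1/2 + B" "cmod x2 \<le> 1/2 + B" for v x1 x2
      unfolding norm_mult complex_mod_cnj
      by (intro mult_mono order_trans[OF norm_triangle_ineq] add_mono)
        (use e that \<open>0 \<le> B\<close> in \<open>auto simp: norm_mult intro!: mult_mono\<close>)
    have "cmod (energy_density (perturbed p) U t) \<le> e * ((1/2 + B) * e + (1/2 + B) * e) + e * ((1/2 + B) * e + (1/2 + B) * e)"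
      unfolding energy_density_perturbed U by (intro order_trans[OF norm_triangle_ineq] add_mono le e n)
    also have "\<dots> = 4 * D\<^sup>2 * (1/2 + B) * exp (- (2 * c) * t)"
      unfolding e_def by (simp add: algebra_simps power2_eq_square mult_exp_exp)
    finally show "cmod (energy_density (perturbed p) U t) \<le> 4 * D\<^sup>2 * (1/2 + B) * exp (- (2 * c) * t)" .
  qed auto
  ultimately show "\<exists>Y. square_integrable_solution (perturbed p) z Y \<and> Y 0 = vector [1, u2 0]"
    unfolding square_integrable_solution_def using u(4) by (intro exI[of _ U]) (simp add: U_def)
next
  fix m assume "\<exists>Y. square_integrable_solution (perturbed p) z Y \<and> Y 0 = vector [1, m]"
  then obtain Y where Y: "canonical_solution (perturbed p) z Y" "energy_density (perturbed p) Y absolutely_integrable_on {0..}"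
    "Y 0 = vector [1, m]"
    unfolding square_integrable_solution_def by blast
  note y = canonical_solution_solves_off[OF Y(1) p(4)]
  \<comment> \<open>The Wronskian of the initial values (1, m) and (1, u2 0).\<close>
  define W where "W = u2 0 - m"
  have W: "vec_nth (Y t) 1 * u2 t - vec_nth (Y t) 2 * u1 t = W" if "0 \<le> t" for t
    using solves_off_wronskian[OF y(1) u(1) K that y(2,3)] u(2,3,4) Y(3)
    by (auto simp: W_def intro: continuous_on_subset)
  show "m = u2 0"
  proof (rule ccontr)
    assume "m \<noteq> u2 0"
    then have "W \<noteq> 0" by (simp add: W_def)
    have "0 < D" using decay(2)[of 0] u(4) by simp
    \<comment> \<open>With r, s the moduli of the components of \<open>Y\<close>, |W| \<le> D (r +
      s) and (r + s)^2 \<le> 2 (r^2 + s^2), while the density on the tail is (r^2 + s^2)/2; hence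
      the 4.\<close>
    have "(cmod W)\<^sup>2 / (4 * D\<^sup>2) \<le> cmod (energy_density (perturbed p) Y t)" if t: "\<Lambda> \<le> t" for t
    proof -
      define r s where "r = cmod (vec_nth (Y t) 1)" and "s = cmod (vec_nth (Y t) 2)"
      have "0 \<le> t" using \<Lambda> t by simp
      have "D * exp (- c * t) \<le> D"
        using \<open>0 < D\<close> \<open>0 < c\<close> \<open>0 \<le> t\<close> by (simp add: mult_le_cancel_left1)
      then have u: "cmod (u1 t) \<le> D" "cmod (u2 t) \<le> D"
        using decay(2,3)[OF \<open>0 \<le> t\<close>] by linarith+
      have "cmod W \<le> r * D + s * D"
        unfolding W[OF \<open>0 \<le> t\<close>, symmetric]
        by (intro order_trans[OF norm_triangle_ineq4] add_mono)
          (use u in \<open>auto simp: norm_mult r_def s_def intro!: mult_left_mono\<close>)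
      then have "(cmod W)\<^sup>2 \<le> (r * D + s * D)\<^sup>2"
        by (intro power_mono) auto
      also have "\<dots> = D\<^sup>2 * (2 * (r\<^sup>2 + s\<^sup>2) - (r - s)\<^sup>2)"
        by (simp add: power2_eq_square algebra_simps)
      also have "\<dots> \<le> D\<^sup>2 * (2 * (r\<^sup>2 + s\<^sup>2))"
        by (intro mult_left_mono) auto
      finally have "(cmod W)\<^sup>2 / (4 * D\<^sup>2) \<le> (r\<^sup>2 + s\<^sup>2) / 2"
        using \<open>0 < D\<close> by (simp add: field_simps)
      also have "\<dots> = cmod (energy_density (perturbed p) Y t)"
        unfolding energy_density_free_tail[where p = p and s = t, OF p(3)[OF t]] norm_of_real by (simp add: r_def s_def)
      finally show ?thesis .
    qed
    then show False
      using not_absolutely_integrable_bounded_below[OF Y(2) _ \<Lambda>, of "(cmod W)\<^sup>2 / (4 * D\<^sup>2)"] \<open>W \<noteq> 0\<close> \<open>0 < D\<close>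
      by simp
  qed
qed

text \<open>Decay is explicit only on the tail; on the compact interval before it continuity
  supplies a constant, so one bound covers the half-line.\<close>

lemma exponential_decay_bound:
  fixes a :: "real \<Rightarrow> complex"
  assumes "continuous_on UNIV a" and "\<And>t. \<Lambda> \<le> t \<Longrightarrow> cmod (a t) \<le> D * exp (- c * t)"
  shows "\<exists>D'. \<forall>t\<ge>0. cmod (a t) \<le> D' * exp (- c * t)"
proof -
  have "bounded ((\<lambda>t. a t * of_real (exp (c * t))) ` {0..\<Lambda>})"
    by (intro compact_imp_bounded compact_continuous_image continuous_intros continuous_on_subset[OF assms(1)]) auto
  then obtain M where "\<forall>t\<in>{0..\<Lambda>}. cmod (a t) * exp (c * t) \<le> M"
    unfolding bounded_iff by (auto simp: norm_mult)
  then have M: "cmod (a t) * exp (c * t) \<le> M" if "0 \<le> t" "t \<le> \<Lambda>" for t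
    using that by auto
  have "cmod (a t) \<le> max M D * exp (- c * t)" if t: "0 \<le> t" for t
  proof (cases "t \<le> \<Lambda>")
    case True
    then have "cmod (a t) * exp (c * t) * exp (- c * t) \<le> max M D * exp (- c * t)"
      using M[OF t] by (intro mult_right_mono) auto
    then show ?thesis by (simp add: mult.assoc flip: exp_add)
  next
    case False
    then have "cmod (a t) \<le> D * exp (- c * t)" using assms(2) by simp
    also have "\<dots> \<le> max M D * exp (- c * t)" by (intro mult_right_mono) auto
    finally show ?thesis .
  qed
  then show ?thesis by blast
qed

text \<open>The difference quotient at 0 is \<open>h\<close> itself, so continuity suffices.\<close>

lemma has_vector_derivative_scaled_at_0:
  fixes h :: "real \<Rightarrow> complex"
  assumes "isCont h 0"
  shows "((\<lambda>\<tau>. of_real \<tau> * h \<tau>) has_vector_derivative h 0) (at 0)"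
proof -
  have "((\<lambda>\<tau>. norm (h \<tau> - h 0)) \<longlongrightarrow> 0) (at 0)"
    using assms by (simp add: isCont_def tendsto_norm_zero_iff LIM_zero_iff)
  moreover have "norm (of_real \<tau> * h \<tau> - of_real \<tau> * h 0) / norm \<tau> = norm (h \<tau> - h 0)" if "\<tau> \<noteq> 0" for \<tau>
    using that by (simp add: norm_mult flip: right_diff_distrib)
  ultimately have "((\<lambda>\<tau>. norm (of_real \<tau> * h \<tau> - of_real \<tau> * h 0) / norm \<tau>) \<longlongrightarrow> 0) (at 0)"
    by (subst LIM_cong[OF refl _ refl]) auto
  then show ?thesis
    using bounded_linear_scaleR_left[of "h 0"]
    by (simp add: has_vector_derivative_def has_derivative_iff_norm scaleR_conv_of_real)
qed

section \<open>The derivative of the Schur transform\<close>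

lemma block_function_measurable: "block_function \<Lambda> N v \<in> borel_measurable borel"
  unfolding block_function_def Let_def by measurable

lemma norm_block_function_le: "cmod (block_function \<Lambda> N v s) \<le> (\<Sum>j<N. cmod (vec_index v j))"
  unfolding block_function_def Let_def
  by (intro order_trans[OF norm_sum] sum_mono) (simp add: norm_mult indicator_def)

lemma block_function_block:
  assumes l: "l = \<Lambda> / real N" "0 < l" and "j < N" "real j * l \<le> s" "s < real (Suc j) * l"
  shows "block_function \<Lambda> N v s = vec_index v j"
proof -
  have ind: "(indicator {real i * l ..< (real i + 1) * l} s :: complex) = (if i = j then 1 else 0)" for i
  proof (cases i j rule: linorder_cases)
    case less
    then have "(real i + 1) * l \<le> real j * l" using \<open>0 < l\<close> by (intro mult_right_mono) auto
    then show ?thesis using less assms by simp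
  next
    case greater
    then have "real (Suc j) * l \<le> real i * l" using \<open>0 < l\<close> by (intro mult_right_mono) auto
    then show ?thesis using greater assms by simp
  qed (use assms in \<open>simp add: add.commute\<close>)
  show ?thesis
    unfolding block_function_def Let_def l(1)[symmetric] ind
    using \<open>j < N\<close> by (simp add: if_distrib[of "(*) _"] cong: if_cong)
qed

lemma block_function_tail:
  assumes l: "l = \<Lambda> / real N" "0 < l" and "real N * l \<le> s"
  shows "block_function \<Lambda> N v s = 0"
proof -
  have ind: "(indicator {real i * l ..< (real i + 1) * l} s :: complex) = 0" if "i < N" for i
  proof -
    have "(real i + 1) * l \<le> real N * l" using that \<open>0 < l\<close> by (intro mult_right_mono) auto
    then show ?thesis using assms by simp
  qed
  show ?thesis
    unfolding block_function_def Let_def l(1)[symmetric]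
    by (rule sum.neutral) (metis ind lessThan_iff mult_zero_right)
qed

lemma isCont_block_function:
  assumes l: "l = \<Lambda> / real N" "0 < l" and t: "0 < t" "t \<notin> (\<lambda>j. real j * l) ` {..N}"
  shows "isCont (block_function \<Lambda> N v) t"
proof -
  have *: "isCont (block_function \<Lambda> N v) t" if "open S" "t \<in> S" "\<And>s. s \<in> S \<Longrightarrow> block_function \<Lambda> N v s = d" for S d
  proof -
    have "continuous_on S (block_function \<Lambda> N v)"
      using that by (subst continuous_on_cong[OF refl that(3)]) auto
    then show ?thesis using that continuous_on_eq_continuous_at by blast
  qed
  show ?thesis
  proof (cases "t \<ge> real N * l")
    case True
    then have "t > real N * l" using t by (cases "t = real N * l") auto
    then show ?thesis
      using block_function_tail[OF l] by (intro *[of "{real N * l<..}"]) auto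
  next
    case False
    define j where "j = nat \<lfloor>t / l\<rfloor>"
    have "0 \<le> t / l" using t(1) l(2) by simp
    then have "real j \<le> t / l" "t / l < real j + 1"
      unfolding j_def by linarith+
    then have j': "real j * l \<le> t" "t < real (Suc j) * l"
      using l(2) by (simp_all add: pos_le_divide_eq pos_divide_less_eq add.commute)
    have "real j * l < real N * l" using j' False by linarith
    then have "j < N" using l(2) by simp
    moreover have "t \<noteq> real j * l" using t \<open>j < N\<close> by auto
    ultimately show ?thesis
      using j' block_function_block[OF l \<open>j < N\<close>]
      by (intro *[of "{real j * l<..<real (Suc j) * l}"]) auto
  qed
qed

text \<open>The block function vanishes from \<Lambda> on, so the free tail needs no separate case:
  one coefficient function describes the whole half-line.\<close>

lemma extend_free_block:
  assumes "l = \<Lambda> / real N" "0 < l" "0 < N"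
  shows "extend_free \<Lambda> (\<lambda>s. free_hamiltonian s + \<tau> *\<^sub>R X_mat (block_function \<Lambda> N v s)) =
    perturbed (\<lambda>s. of_real \<tau> * block_function \<Lambda> N v s)"
proof
  fix s
  have X: "X_mat (of_real \<tau> * w) = \<tau> *\<^sub>R X_mat w" for w
    by (simp add: Finite_Cartesian_Product.vec_eq_iff forall_2 X_mat_def)
  have "block_function \<Lambda> N v s = 0" if "\<not> s < \<Lambda>"
    using that assms by (intro block_function_tail[of l]) auto
  moreover have "X_mat 0 = 0"
    by (simp add: Finite_Cartesian_Product.vec_eq_iff forall_2 X_mat_def)
  ultimately show "extend_free \<Lambda> (\<lambda>s. free_hamiltonian s + \<tau> *\<^sub>R X_mat (block_function \<Lambda> N v s)) s =
    perturbed (\<lambda>s. of_real \<tau> * block_function \<Lambda> N v s) s"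
    by (simp add: extend_free_def X free_hamiltonian_def)
qed

text \<open>The eigenvectors (1, i) and (1, -i) correspond to m = i and m = -i, which the Schur
  transform sends to 0 and infinity; so it reads off the ratio of the diagonal coordinates.\<close>

lemma schur_transform_diagonal:
  assumes "a \<noteq> 0" "a + b \<noteq> (0::complex)"
    and "weyl_coefficient H \<Lambda> z = \<i> * (a - b) / (a + b)"
  shows "schur_transform H \<Lambda> z = - b / a"
proof -
  have eqs: "\<i> * (a - b) / (a + b) - \<i> = - 2 * \<i> * b / (a + b)" "\<i> * (a - b) / (a + b) + \<i> = 2 * \<i> * a / (a + b)"
    using assms(2) by (simp_all add: field_simps)
  then show ?thesis
    unfolding schur_transform_def assms(3) eqs using assms(1,2) by simp
qed

lemma schur_path_has_vector_derivative:
  assumes \<Lambda>: "0 < \<Lambda>" and N: "1 \<le> N" and l: "l = \<Lambda> / real N" and z: "0 < Im z"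
  defines "E \<equiv> exp (\<i> * z * of_real l / 2)"
  shows "(schur_path \<Lambda> z (block_function \<Lambda> N v) has_vector_derivative
      (1 - E\<^sup>2) * (\<Sum>j<N. vec_index v j * E ^ (2 * j))) (at 0)"
proof -
  have l0: "0 < l" using \<Lambda> N l by simp
  have Nl: "real N * l = \<Lambda>" using N l by simp
  define q where "q = block_function \<Lambda> N v"
  define R where "R = (\<Sum>j<N. cmod (vec_index v j))"
  define K where "K = (\<lambda>j. real j * l) ` {..N}"
  have qR: "cmod (q s) \<le> R" for s
    unfolding q_def R_def by (rule norm_block_function_le)
  have vR: "cmod (vec_index v j) \<le> R" if "j < N" for j
    unfolding R_def using that by (intro member_le_sum) auto
  have "z \<noteq> 0" using z by auto
  have E0: "E \<noteq> 0" by (simp add: E_def)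
  have "\<exists>\<alpha> G :: real \<Rightarrow> complex. isCont \<alpha> 0 \<and> isCont G 0 \<and> \<alpha> 0 = 1 / E ^ N \<and>
    G 0 = - (1 - E\<^sup>2) / E ^ N * (\<Sum>i<N. vec_index v (N - N + i) * E ^ (2 * i)) \<and>
    (\<forall>\<tau>. \<bar>\<tau>\<bar> * R < 1/2 \<longrightarrow> (\<exists>a b. continuous_on UNIV a \<and> continuous_on UNIV b \<and>
       diag_solves_off K (real (N - N) * l) (\<lambda>t. of_real \<tau> * q t) z a b \<and>
       a (real (N - N) * l) = \<alpha> \<tau> \<and> b (real (N - N) * l) = of_real \<tau> * G \<tau> \<and>
       (\<forall>t \<ge> real N * l. a t = exp (\<i> * z * of_real (t - real N * l) / 2) \<and> b t = 0)))"
    unfolding E_def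
    by (rule block_solution[OF \<open>z \<noteq> 0\<close> _ vR _ _ K_def order_refl])
      (use l0 block_function_block[OF l l0] block_function_tail[OF l l0] in \<open>auto simp: q_def\<close>)
  then obtain \<alpha> G :: "real \<Rightarrow> complex" where cont: "isCont \<alpha> 0" "isCont G 0"
    and \<alpha>0: "\<alpha> 0 = 1 / E ^ N" and G0: "G 0 = - (1 - E\<^sup>2) / E ^ N * (\<Sum>i<N. vec_index v i * E ^ (2 * i))"
    and sol: "\<And>\<tau>. \<bar>\<tau>\<bar> * R < 1/2 \<Longrightarrow> \<exists>a b. continuous_on UNIV a \<and> continuous_on UNIV b \<and>
       diag_solves_off K 0 (\<lambda>t. of_real \<tau> * q t) z a b \<and> a 0 = \<alpha> \<tau> \<and> b 0 = of_real \<tau> * G \<tau> \<and>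
       (\<forall>t \<ge> \<Lambda>. a t = exp (\<i> * z * of_real (t - \<Lambda>) / 2) \<and> b t = 0)"
    unfolding Nl by auto
  have \<alpha>0': "\<alpha> 0 \<noteq> 0" using \<alpha>0 E0 by simp
  \<comment> \<open>The three conditions are those under which the closed form makes sense: nonzero
    rates, nonzero a(0), and a first component at 0 that can be normalised. All of them hold near
    \<tau> = 0.\<close>
  have path: "schur_path \<Lambda> z q \<tau> = of_real \<tau> * (- G \<tau> / \<alpha> \<tau>)"
    if \<tau>: "\<bar>\<tau>\<bar> * R < 1/2" "\<alpha> \<tau> \<noteq> 0" "\<alpha> \<tau> + of_real \<tau> * G \<tau> \<noteq> 0" for \<tau>
  proof -
    obtain a b where ab: "continuous_on UNIV a" "continuous_on UNIV b"
       "diag_solves_off K 0 (\<lambda>t. of_real \<tau> * q t) z a b" "a 0 = \<alpha> \<tau>" "b 0 = of_real \<tau> * G \<tau>"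
       and tail: "\<forall>t \<ge> \<Lambda>. a t = exp (\<i> * z * of_real (t - \<Lambda>) / 2) \<and> b t = 0"
      using sol[OF \<tau>(1)] by (elim exE conjE) (rule that)
    define d where "d = 1 / (a 0 + b 0)"
    define u1 where "u1 t = d * (a t + b t)" for t
    define u2 where "u2 t = d * (\<i> * (a t - b t))" for t
    \<comment> \<open>The decay rate of the tail, as |e^{izt/2}| = e^{-t Im z/2}.\<close>
    define c where "c = Im z / 2"
    have cu: "continuous_on UNIV u1" "continuous_on UNIV u2"
      unfolding u1_def u2_def by (intro continuous_intros ab)+
    have u: "cmod (u1 t) \<le> (cmod d * exp (c * \<Lambda>)) * exp (- c * t) \<and> cmod (u2 t) \<le> (cmod d * exp (c * \<Lambda>)) * exp (- c * t)"
      if "\<Lambda> \<le> t" for t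
      using tail that by (simp add: u1_def u2_def norm_mult c_def algebra_simps diff_divide_distrib mult_exp_exp)
    obtain D1 where D1: "\<And>t. 0 \<le> t \<Longrightarrow> cmod (u1 t) \<le> D1 * exp (- c * t)"
      using exponential_decay_bound[OF cu(1), of \<Lambda>] u by blast
    obtain D2 where D2: "\<And>t. 0 \<le> t \<Longrightarrow> cmod (u2 t) \<le> D2 * exp (- c * t)"
      using exponential_decay_bound[OF cu(2), of \<Lambda>] u by blast
    have "weyl_coefficient (\<lambda>s. free_hamiltonian s + \<tau> *\<^sub>R X_mat (q s)) \<Lambda> z = u2 0"
    proof (rule weyl_coefficient_eq[where p = "\<lambda>s. of_real \<tau> * q s" and B = "\<bar>\<tau>\<bar> * R" and K = K and ?u1.0 = u1 and c = c and D = "max D1 D2"])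
      show "extend_free \<Lambda> (\<lambda>s. free_hamiltonian s + \<tau> *\<^sub>R X_mat (q s)) = perturbed (\<lambda>s. of_real \<tau> * q s)"
        unfolding q_def using extend_free_block[OF l l0] N by simp
      show "(\<lambda>s. of_real \<tau> * q s) \<in> borel_measurable borel"
        using block_function_measurable[of \<Lambda> N v] unfolding q_def by measurable
      show "cmod (of_real \<tau> * q s) \<le> \<bar>\<tau>\<bar> * R" for s
        using qR by (simp add: norm_mult mult_left_mono)
      show "of_real \<tau> * q s = 0" if "\<Lambda> \<le> s" for s
        using block_function_tail[OF l l0] that unfolding Nl by (simp add: q_def)
      show "isCont (\<lambda>s. of_real \<tau> * q s) t" if "0 < t" "t \<notin> K" for t
        using isCont_block_function[OF l l0] that unfolding K_def q_def by (auto intro!: continuous_intros)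
      show "solves_off K (\<lambda>s. of_real \<tau> * q s) z u1 u2"
        unfolding u1_def u2_def by (rule diag_solves_off_solves_off[OF ab(3)])
      show "cmod (u1 t) \<le> max D1 D2 * exp (- c * t)" if "0 \<le> t" for t
        using D1[OF that] by (rule order_trans) (simp add: mult_right_mono)
      show "cmod (u2 t) \<le> max D1 D2 * exp (- c * t)" if "0 \<le> t" for t
        using D2[OF that] by (rule order_trans) (simp add: mult_right_mono)
    qed (use \<Lambda> z cu \<tau> ab in \<open>auto simp: K_def c_def u1_def d_def\<close>)
    also have "u2 0 = \<i> * (\<alpha> \<tau> - of_real \<tau> * G \<tau>) / (\<alpha> \<tau> + of_real \<tau> * G \<tau>)"
      by (simp add: u2_def d_def ab)
    finally have "schur_path \<Lambda> z q \<tau> = - (of_real \<tau> * G \<tau>) / \<alpha> \<tau>"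
      unfolding schur_path_def by (rule schur_transform_diagonal[OF \<tau>(2,3)])
    then show ?thesis by simp
  qed
  have "isCont (\<lambda>\<tau>. - G \<tau> / \<alpha> \<tau>) 0"
    using cont \<alpha>0' by (intro continuous_intros)
  then have "((\<lambda>\<tau>. of_real \<tau> * (- G \<tau> / \<alpha> \<tau>)) has_vector_derivative - G 0 / \<alpha> 0) (at 0)"
    by (rule has_vector_derivative_scaled_at_0)
  moreover have "- G 0 / \<alpha> 0 = (1 - E\<^sup>2) * (\<Sum>j<N. vec_index v j * E ^ (2 * j))"
    unfolding G0 \<alpha>0 using E0 by (simp flip: mult_minus_left)
  \<comment> \<open>The neighbourhood includes \<tau> = 0, because the derivative depends on the
    value there as well.\<close>
  moreover have "\<forall>\<^sub>F \<tau> in nhds 0. of_real \<tau> * (- G \<tau> / \<alpha> \<tau>) = schur_path \<Lambda> z q \<tau>"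
  proof -
    have ev: "\<forall>\<^sub>F \<tau> in nhds 0. f \<tau> \<noteq> 0" if "isCont f 0" "f 0 \<noteq> 0" for f :: "real \<Rightarrow> complex"
      using tendsto_imp_eventually_ne[OF isContD[OF that(1)] that(2)] that(2) by (simp add: eventually_nhds_conv_at)
    have "isCont (\<lambda>\<tau>. \<bar>\<tau>\<bar> * R) (0::real)" by (intro continuous_intros)
    then have "((\<lambda>\<tau>. \<bar>\<tau>\<bar> * R) \<longlongrightarrow> 0) (at (0::real))" by (simp add: isCont_def)
    then have "\<forall>\<^sub>F \<tau> in at (0::real). \<bar>\<tau>\<bar> * R < 1/2"
      by (rule order_tendstoD) simp
    then have "\<forall>\<^sub>F \<tau> in nhds (0::real). \<bar>\<tau>\<bar> * R < 1/2"
      by (simp add: eventually_nhds_conv_at)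
    moreover have "\<forall>\<^sub>F \<tau> in nhds 0. \<alpha> \<tau> \<noteq> 0"
      using cont \<alpha>0' by (intro ev)
    moreover have "\<forall>\<^sub>F \<tau> in nhds 0. \<alpha> \<tau> + of_real \<tau> * G \<tau> \<noteq> 0"
      using cont \<alpha>0' by (intro ev continuous_intros) auto
    ultimately show ?thesis
      by eventually_elim (rule path[symmetric])
  qed
  ultimately show ?thesis
    unfolding q_def[symmetric]
    by (subst has_vector_derivative_cong_ev[symmetric, where f = "\<lambda>\<tau>. of_real \<tau> * (- G \<tau> / \<alpha> \<tau>)"])
      (auto dest: eventually_nhds_x_imp_x)
qed

section \<open>Singular values of the factors\<close>

text \<open>With E = e^{izl/2} one has -2i sin(zl/2) = 1/E - E, and the phase e^{ixl/2} of the row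
  factor is E without its decay e^{-\<eta>l/2}. The missing decay is the 1/2 in the exponent of the
  column weight.\<close>

lemma jacobian_entry:
  fixes l :: real
  assumes "z = Complex x \<eta>"
  defines "E \<equiv> exp (\<i> * z * of_real l / 2)"
  shows "row_factor \<eta> l x * exp (\<i> * of_real (x * real j * l)) * of_real (exp (- \<eta> * (real j + 1/2) * l)) =
    (1 - E\<^sup>2) * E ^ (2 * j)"
proof -
  have iz: "\<i> * z = \<i> * of_real x - of_real \<eta>"
    by (simp add: assms(1) complex_eq_iff)
  have E: "E = exp (\<i> * of_real (x * l / 2)) * exp (- of_real (\<eta> * l / 2))"
    unfolding E_def iz by (simp add: algebra_simps diff_divide_distrib flip: exp_add)
  have "- 2 * \<i> * sin (z * of_real l / 2) = 1 / E - E"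
    by (simp add: sin_exp_eq E_def exp_minus field_simps)
  then have "row_factor \<eta> l x * exp (- of_real (\<eta> * l / 2)) = (1 / E - E) * E"
    unfolding row_factor_def assms(1)[symmetric] E by (simp add: mult.assoc)
  also have "\<dots> = 1 - E\<^sup>2"
    by (simp add: E_def algebra_simps power2_eq_square)
  finally have rf: "row_factor \<eta> l x * exp (- of_real (\<eta> * l / 2)) = 1 - E\<^sup>2" .
  have "exp (\<i> * of_real (x * real j * l)) * of_real (exp (- \<eta> * (real j + 1/2) * l)) =
      exp (- of_real (\<eta> * l / 2)) * E ^ (2 * j)"
    unfolding E power_mult_distrib
    by (simp add: exp_of_real[symmetric] algebra_simps add_divide_distrib flip: exp_of_nat_mult exp_add)
  then have "row_factor \<eta> l x * exp (\<i> * of_real (x * real j * l)) * of_real (exp (- \<eta> * (real j + 1/2) * l)) =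
      row_factor \<eta> l x * exp (- of_real (\<eta> * l / 2)) * E ^ (2 * j)"
    by (simp add: mult.assoc)
  then show ?thesis unfolding rf .
qed

lemma mat_diag_mult_vec:
  assumes "u \<in> carrier_vec n"
  shows "mat_diag n f *\<^sub>v u = Matrix.vec n (\<lambda>i. f i * vec_index u i)"
  using assms
  by (intro eq_vecI) (auto simp: mat_diag_def scalar_prod_def if_distrib[of "\<lambda>x. x * _"] cong: if_cong)

lemma mat_mult_vec_index:
  assumes "i < m" "u \<in> carrier_vec n"
  shows "vec_index (Matrix.mat m n f *\<^sub>v u) i = (\<Sum>j<n. f (i, j) * vec_index u j)"
  using assms by (simp add: scalar_prod_def atLeast0LessThan)

lemma vec_norm2_power2: "(vec_norm2 u)\<^sup>2 = (\<Sum>i<dim_vec u. (cmod (vec_index u i))\<^sup>2)"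
  by (simp add: vec_norm2_def L2_set_def sum_nonneg)

lemma vec_norm2_nonneg [simp]: "0 \<le> vec_norm2 u"
  by (simp add: vec_norm2_def)

lemma vec_norm2_unit_vec:
  assumes "j < n"
  shows "vec_norm2 (unit_vec n j) = 1"
proof -
  have "(vec_norm2 (unit_vec n j))\<^sup>2 = (\<Sum>i<n. if i = j then 1 else 0)"
    unfolding vec_norm2_power2 by (rule sum.cong) (auto simp: unit_vec_def)
  then show ?thesis using assms by (simp add: power2_eq_1_iff) (metis neg_0_le_iff_le not_one_le_zero vec_norm2_nonneg)
qed

lemma vec_norm2_diag_ge:
  assumes "u \<in> carrier_vec n" "0 \<le> c" "\<And>i. i < n \<Longrightarrow> c \<le> cmod (f i)"
  shows "c * vec_norm2 u \<le> vec_norm2 (mat_diag n f *\<^sub>v u)"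
proof (rule power2_le_imp_le)
  show "(c * vec_norm2 u)\<^sup>2 \<le> (vec_norm2 (mat_diag n f *\<^sub>v u))\<^sup>2"
    unfolding power_mult_distrib vec_norm2_power2 mat_diag_mult_vec[OF assms(1)] sum_distrib_left
    using assms by (auto simp: norm_mult power_mult_distrib intro!: sum_mono mult_right_mono power_mono)
qed simp

lemma sigma_min_le:
  assumes "u \<in> carrier_vec n" "vec_norm2 u = 1"
  shows "sigma_min n A \<le> vec_norm2 (A u)"
  unfolding sigma_min_def using assms
  by (intro cInf_lower) (auto intro!: bdd_belowI[of _ 0])

lemma sigma_min_ge:
  assumes "1 \<le> n" "\<And>u. u \<in> carrier_vec n \<Longrightarrow> vec_norm2 u = 1 \<Longrightarrow> c \<le> vec_norm2 (A u)"
  shows "c \<le> sigma_min n A"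
  unfolding sigma_min_def
proof (rule cInf_greatest)
  have "vec_norm2 (unit_vec n 0) = 1" using assms(1) by (intro vec_norm2_unit_vec) simp
  then show "{vec_norm2 (A u) |u. u \<in> carrier_vec n \<and> vec_norm2 u = 1} \<noteq> {}"
    using unit_vec_carrier by blast
qed (use assms(2) in auto)

text \<open>Unit vectors realise every diagonal modulus, and the least of these bounds the norm from
  below.\<close>

lemma sigma_min_mat_diag:
  assumes "1 \<le> n"
  shows "sigma_min_mat (mat_diag n f) = Min ((\<lambda>i. cmod (f i)) ` {..<n})"
proof (rule antisym)
  have ne: "(\<lambda>i. cmod (f i)) ` {..<n} \<noteq> {}" using assms by (auto simp: lessThan_empty_iff)
  have d: "dim_col (mat_diag n f) = n" by (simp add: mat_diag_def)
  show "sigma_min_mat (mat_diag n f) \<le> Min ((\<lambda>i. cmod (f i)) ` {..<n})"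
  proof (subst Min_ge_iff)
    show "\<forall>a\<in>(\<lambda>i. cmod (f i)) ` {..<n}. sigma_min_mat (mat_diag n f) \<le> a"
    proof safe
      fix j assume "j < n"
      have "(vec_norm2 (mat_diag n f *\<^sub>v unit_vec n j))\<^sup>2 = (\<Sum>i<n. if i = j then (cmod (f j))\<^sup>2 else 0)"
        unfolding vec_norm2_power2 mat_diag_mult_vec[OF unit_vec_carrier]
        by (rule sum.cong) (auto simp: unit_vec_def)
      then have "vec_norm2 (mat_diag n f *\<^sub>v unit_vec n j) = cmod (f j)"
        using \<open>j < n\<close> by simp
      then show "sigma_min_mat (mat_diag n f) \<le> cmod (f j)"
        using sigma_min_le[OF unit_vec_carrier vec_norm2_unit_vec[OF \<open>j < n\<close>], of "\<lambda>u. mat_diag n f *\<^sub>v u"] d by simp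
    qed
  qed (use ne in auto)
  show "Min ((\<lambda>i. cmod (f i)) ` {..<n}) \<le> sigma_min_mat (mat_diag n f)"
    unfolding d
  proof (rule sigma_min_ge[OF assms])
    fix u :: "complex Matrix.vec" assume u: "u \<in> carrier_vec n" "vec_norm2 u = 1"
    have "0 \<le> Min ((\<lambda>i. cmod (f i)) ` {..<n})" using ne by (subst Min_ge_iff) auto
    then show "Min ((\<lambda>i. cmod (f i)) ` {..<n}) \<le> vec_norm2 (mat_diag n f *\<^sub>v u)"
      using vec_norm2_diag_ge[OF u(1), of "Min ((\<lambda>i. cmod (f i)) ` {..<n})" f] u(2) by simp
  qed
qed

lemma norm_row_factor:
  "cmod (row_factor \<eta> l t) = 2 * sqrt ((sinh (\<eta> * l / 2))\<^sup>2 + (sin (t * l / 2))\<^sup>2)"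
proof -
  have z: "Complex t \<eta> * of_real l / 2 = Complex (t * l / 2) (\<eta> * l / 2)"
    by (simp add: complex_eq_iff)
  have "(cmod (sin (Complex (t * l / 2) (\<eta> * l / 2))))\<^sup>2 = (sinh (\<eta> * l / 2))\<^sup>2 + (sin (t * l / 2))\<^sup>2"
  proof -
    \<comment> \<open>In terms of this exponential the claim becomes a rational identity in
      \<open>w\<close>.\<close>
    define w where "w = exp (\<eta> * l / 2)"
    have "w \<noteq> 0" by (simp add: w_def)
    have e: "exp (2 * (\<eta> * l / 2)) = w\<^sup>2" "sinh (\<eta> * l / 2) = (w - 1 / w) / 2"
      by (simp_all add: w_def sinh_field_def exp_minus inverse_eq_divide flip: exp_double)
    show ?thesis
      unfolding norm_sin_squared complex.sel e cos_double_sin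
      using \<open>w \<noteq> 0\<close> by (simp add: power2_eq_square field_simps)
  qed
  then have "cmod (sin (Complex (t * l / 2) (\<eta> * l / 2))) = sqrt ((sinh (\<eta> * l / 2))\<^sup>2 + (sin (t * l / 2))\<^sup>2)"
    by (metis norm_ge_zero real_sqrt_unique)
  then show ?thesis
    unfolding row_factor_def z by (simp add: norm_mult)
qed

text \<open>The shift \<alpha> only multiplies column j by the unimodular factor e^{2i\<alpha>j}.
  What remains are N columns of the M-point Fourier matrix, which are distinct and hence orthogonal
  because N \<le> M.\<close>

lemma F_mat_equispaced_isometry:
  assumes "N \<le> M" "1 \<le> M" "l \<noteq> 0" and u: "u \<in> carrier_vec N"
  shows "vec_norm2 (F_mat l M N (equispaced_design M l \<alpha>) *\<^sub>v u) = sqrt (real M) * vec_norm2 u"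
proof -
  define \<omega> where "\<omega> j = exp (2 * of_real pi * \<i> * of_nat j / of_nat M)" for j
  define c where "c j = exp (\<i> * of_real (2 * \<alpha> * real j)) * vec_index u j" for j
  have norm_\<omega>: "\<omega> j * cnj (\<omega> j) = 1" for j
  proof -
    have "\<omega> j = exp (\<i> * of_real (2 * pi * real j / real M))" by (simp add: \<omega>_def mult_ac)
    then show ?thesis using complex_norm_square[of "\<omega> j"] by simp
  qed
  have entry: "exp (\<i> * of_real (equispaced_design M l \<alpha> (Suc i) * real j * l)) * vec_index u j = c j * \<omega> j ^ i" for i j
  proof -
    have "equispaced_design M l \<alpha> (Suc i) * real j * l = 2 * \<alpha> * real j + real i * (2 * pi * real j / real M)"
      using assms by (simp add: equispaced_design_def field_simps)
    then show ?thesis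
      unfolding c_def \<omega>_def by (simp add: exp_add distrib_left mult_ac flip: exp_of_nat_mult)
  qed
  have gp: "(\<Sum>i<M. (\<omega> j * cnj (\<omega> k)) ^ i) = (if j = k then of_nat M else 0)" if "j < M" "k < M" for j k
  proof (cases "j = k")
    case False
    \<comment> \<open>Different indices below M are incongruent modulo M, so the ratio of the two
      roots is not 1 and the geometric sum vanishes.\<close>
    have "\<omega> j \<noteq> \<omega> k"
      unfolding \<omega>_def using complex_root_unity_eq[of M j k] assms that False by (simp add: cong_def)
    moreover have "\<omega> j = \<omega> j * cnj (\<omega> k) * \<omega> k" using norm_\<omega>[of k] by (simp add: mult_ac)
    ultimately have "\<omega> j * cnj (\<omega> k) \<noteq> 1" by (metis mult_1)
    moreover have "(\<omega> j * cnj (\<omega> k)) ^ M = 1"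
      unfolding power_mult_distrib complex_cnj_power[symmetric] \<omega>_def
      using assms by (simp add: complex_root_unity)
    ultimately show ?thesis using False by (simp add: geometric_sum)
  qed (simp add: norm_\<omega>)
  have "of_real ((vec_norm2 (F_mat l M N (equispaced_design M l \<alpha>) *\<^sub>v u))\<^sup>2) =
      (\<Sum>i<M. (\<Sum>j<N. c j * \<omega> j ^ i) * cnj (\<Sum>k<N. c k * \<omega> k ^ i))"
  proof -
    have "vec_index (F_mat l M N (equispaced_design M l \<alpha>) *\<^sub>v u) i = (\<Sum>j<N. c j * \<omega> j ^ i)" if "i < M" for i
      unfolding F_mat_def mat_mult_vec_index[OF that u] by (simp only: prod.case entry)
    then show ?thesis
      unfolding vec_norm2_power2 of_real_sum complex_norm_square by (simp add: F_mat_def)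
  qed
  also have "\<dots> = (\<Sum>i<M. \<Sum>j<N. \<Sum>k<N. c j * cnj (c k) * (\<omega> j * cnj (\<omega> k)) ^ i)"
    by (simp add: sum_product power_mult_distrib mult_ac)
  also have "\<dots> = (\<Sum>j<N. \<Sum>k<N. c j * cnj (c k) * (\<Sum>i<M. (\<omega> j * cnj (\<omega> k)) ^ i))"
    unfolding sum_distrib_left by (subst sum.swap, rule sum.cong[OF refl], rule sum.swap)
  also have "\<dots> = (\<Sum>j<N. \<Sum>k<N. if j = k then of_nat M * (c j * cnj (c j)) else 0)"
    by (intro sum.cong refl) (use gp \<open>N \<le> M\<close> in auto)
  also have "\<dots> = of_real (real M * (\<Sum>j<N. (cmod (c j))\<^sup>2))"
    unfolding of_real_mult of_real_sum complex_norm_square by (simp add: sum_distrib_left)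
  also have "(\<Sum>j<N. (cmod (c j))\<^sup>2) = (vec_norm2 u)\<^sup>2"
    unfolding vec_norm2_power2 using u by (simp add: c_def norm_mult)
  finally have "(vec_norm2 (F_mat l M N (equispaced_design M l \<alpha>) *\<^sub>v u))\<^sup>2 = (sqrt (real M) * vec_norm2 u)\<^sup>2"
    unfolding of_real_eq_iff by (simp add: power_mult_distrib)
  then show ?thesis by (simp add: power2_eq_iff_nonneg)
qed

section \<open>The free Jacobian\<close>

text \<open>The closed form of the derivative is already a linear form in the block values, so
  comparing its coefficients with the matrix entries is enough.\<close>

lemma free_jacobian_factorization:
  assumes "0 < \<Lambda>" "0 < \<eta>" "1 \<le> N" "l = \<Lambda> / real N" and v: "v \<in> carrier_vec N"
  shows "free_jacobian \<Lambda> \<eta> M N x v = (D_gamma \<eta> l M x * F_mat l M N x * D_w \<eta> l N) *\<^sub>v v"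
proof -
  define T where "T = Matrix.mat M N (\<lambda>(i, j). row_factor \<eta> l (x (Suc i)) * exp (\<i> * of_real (x (Suc i) * real j * l)) *
      of_real (exp (- \<eta> * (real j + 1/2) * l)))"
  have "D_gamma \<eta> l M x * F_mat l M N x = Matrix.mat M N (\<lambda>(i, j). row_factor \<eta> l (x (Suc i)) * exp (\<i> * of_real (x (Suc i) * real j * l)))"
    unfolding D_gamma_def F_mat_def by (subst mat_diag_mult_left[of _ _ N]) (auto intro!: cong_mat)
  then have T: "D_gamma \<eta> l M x * F_mat l M N x * D_w \<eta> l N = T"
    unfolding D_w_def T_def by (simp only:, subst mat_diag_mult_right[of _ M]) (auto intro!: cong_mat)
  show ?thesis
  proof (rule eq_vecI)
    fix i assume "i < dim_vec ((D_gamma \<eta> l M x * F_mat l M N x * D_w \<eta> l N) *\<^sub>v v)"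
    then have i: "i < M" unfolding T by (simp add: T_def)
    define z where "z = Complex (x (Suc i)) \<eta>"
    define E where "E = exp (\<i> * z * of_real l / 2)"
    have "D_schur_free \<Lambda> z (block_function \<Lambda> N v) = (1 - E\<^sup>2) * (\<Sum>j<N. vec_index v j * E ^ (2 * j))"
      unfolding D_schur_free_def E_def
      by (rule vector_derivative_at, rule schur_path_has_vector_derivative) (use assms in \<open>simp_all add: z_def\<close>)
    also have "\<dots> = (\<Sum>j<N. (1 - E\<^sup>2) * E ^ (2 * j) * vec_index v j)"
      by (simp add: sum_distrib_left mult_ac)
    also have "\<dots> = vec_index (T *\<^sub>v v) i"
      unfolding T_def mat_mult_vec_index[OF i v] prod.case E_def jacobian_entry[OF z_def] ..
    finally show "vec_index (free_jacobian \<Lambda> \<eta> M N x v) i =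
        vec_index ((D_gamma \<eta> l M x * F_mat l M N x * D_w \<eta> l N) *\<^sub>v v) i"
      unfolding T using i by (simp add: free_jacobian_def z_def)
  qed (simp add: free_jacobian_def D_gamma_def mat_diag_def)
qed

text \<open>The last block is seen through the smallest weight, since (N - 1/2) l = \<Lambda> - l/2.
  Its column has entries of modulus |row factor| times this weight, whatever the design.\<close>

lemma sigma_min_free_jacobian_le:
  assumes "0 < \<Lambda>" "0 < \<eta>" "1 \<le> N" and l: "l = \<Lambda> / real N"
  shows "sigma_min N (free_jacobian \<Lambda> \<eta> M N x) \<le> 2 * sqrt (real M) * cosh (\<eta> * l / 2) * exp (- \<eta> * (\<Lambda> - l / 2))"
proof -
  define e where "e = (unit_vec N (N - 1) :: complex Matrix.vec)"
  define w where "w = exp (- \<eta> * (\<Lambda> - l / 2))"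
  have e: "e \<in> carrier_vec N" "vec_norm2 e = 1"
    unfolding e_def using assms by (auto intro!: vec_norm2_unit_vec)
  have w: "w = exp (- \<eta> * (real (N - 1) + 1/2) * l)"
    using assms by (simp add: w_def of_nat_diff field_simps)
  have le: "cmod (vec_index (free_jacobian \<Lambda> \<eta> M N x e) i) \<le> 2 * cosh (\<eta> * l / 2) * w" if i: "i < M" for i
  proof -
    define z where "z = Complex (x (Suc i)) \<eta>"
    define E where "E = exp (\<i> * z * of_real l / 2)"
    have "vec_index (free_jacobian \<Lambda> \<eta> M N x e) i = (1 - E\<^sup>2) * (\<Sum>j<N. vec_index e j * E ^ (2 * j))"
      unfolding free_jacobian_def D_schur_free_def E_def z_def using i
      by (simp, intro vector_derivative_at schur_path_has_vector_derivative) (use assms in simp_all)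
    also have "(\<Sum>j<N. vec_index e j * E ^ (2 * j)) = (\<Sum>j<N. if j = N - 1 then E ^ (2 * (N - 1)) else 0)"
      by (rule sum.cong) (auto simp: e_def unit_vec_def)
    also have "(1 - E\<^sup>2) * \<dots> = (1 - E\<^sup>2) * E ^ (2 * (N - 1))"
      using assms by simp
    also have "\<dots> = row_factor \<eta> l (x (Suc i)) * exp (\<i> * of_real (x (Suc i) * real (N - 1) * l)) * of_real w"
      unfolding w E_def by (rule jacobian_entry[OF z_def, symmetric])
    finally have "cmod (vec_index (free_jacobian \<Lambda> \<eta> M N x e) i) = cmod (row_factor \<eta> l (x (Suc i))) * w"
      by (simp add: norm_mult w_def)
    \<comment> \<open>Bounding the squared sine by 1 leaves sinh^2 + 1 = cosh^2.\<close>
    moreover have "sqrt ((sinh (\<eta> * l / 2))\<^sup>2 + (sin (x (Suc i) * l / 2))\<^sup>2) \<le> cosh (\<eta> * l / 2)"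
      by (rule real_le_lsqrt) (auto simp: cosh_square_eq sin_squared_eq)
    ultimately show ?thesis
      unfolding norm_row_factor by (simp add: w_def)
  qed
  have "vec_norm2 (free_jacobian \<Lambda> \<eta> M N x e) \<le> 2 * sqrt (real M) * cosh (\<eta> * l / 2) * w"
  proof (rule power2_le_imp_le)
    have dim: "dim_vec (free_jacobian \<Lambda> \<eta> M N x e) = M" by (simp add: free_jacobian_def)
    have "(vec_norm2 (free_jacobian \<Lambda> \<eta> M N x e))\<^sup>2 \<le> (\<Sum>i<M. (2 * cosh (\<eta> * l / 2) * w)\<^sup>2)"
      unfolding vec_norm2_power2 dim using le by (intro sum_mono power_mono) auto
    then show "(vec_norm2 (free_jacobian \<Lambda> \<eta> M N x e))\<^sup>2 \<le> (2 * sqrt (real M) * cosh (\<eta> * l / 2) * w)\<^sup>2"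
      by (simp add: power_mult_distrib mult_ac)
  qed (simp add: w_def)
  then show ?thesis
    using sigma_min_le[OF e, of "free_jacobian \<Lambda> \<eta> M N x"] unfolding w_def by linarith
qed

section \<open>Phases of equispaced designs and the optimal shift\<close>

lemma equispaced_phase:
  assumes "l \<noteq> 0" "0 < M"
  shows "equispaced_design M l \<alpha> (Suc i) * l / 2 = \<alpha> + pi * real i / real M"
  using assms by (simp add: equispaced_design_def field_simps)

lemma half_shifted_design_eq: "half_shifted_design M l = equispaced_design M l (pi / (2 * real M))"
proof
  fix k show "half_shifted_design M l k = equispaced_design M l (pi / (2 * real M)) k"
    unfolding half_shifted_design_def equispaced_design_def
    \<comment> \<open>For M = 0 or l = 0 both sides are 0, since division by zero gives 0.\<close>
    by (cases "M = 0"; cases "l = 0") (simp_all add: field_simps)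
qed

text \<open>With h = \<pi>/(2M) the phases h, 3h, ..., \<pi> - h stay at distance at least h from
  the zeros 0 and \<pi> of the sine, which is increasing up to \<pi>/2 and symmetric about
  it.\<close>

lemma half_shift_row_factor_ge:
  assumes "l \<noteq> 0" "i < M"
  shows "2 * sqrt ((sinh (\<eta> * l / 2))\<^sup>2 + (sin (pi / (2 * real M)))\<^sup>2)
    \<le> cmod (row_factor \<eta> l (equispaced_design M l (pi / (2 * real M)) (Suc i)))"
proof -
  define h where "h = pi / (2 * real M)"
  have M: "0 < real M" using assms by simp
  have h: "0 < h" "h \<le> pi / 2" using assms by (simp_all add: h_def field_simps)
  have r: "pi * real i / real M = 2 * h * real i" by (simp add: h_def)
  have "2 * h * real i \<le> 2 * h * (real M - 1)"
    using assms(2) h by (intro mult_left_mono) auto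
  also have "\<dots> = pi - 2 * h" using M by (simp add: h_def field_simps)
  finally have le: "h + 2 * h * real i \<le> pi - h" by simp
  have "sin h \<le> sin (h + 2 * h * real i)"
  proof (cases "h + 2 * h * real i \<le> pi / 2")
    case True
    then show ?thesis using h by (intro sin_monotone_2pi_le) auto
  next
    case False
    have "sin h \<le> sin (pi - (h + 2 * h * real i))"
      using h le False by (intro sin_monotone_2pi_le) auto
    then show ?thesis by simp
  qed
  moreover have "0 \<le> sin h" using h by (intro sin_ge_zero) auto
  ultimately have "(sin h)\<^sup>2 \<le> (sin (h + 2 * h * real i))\<^sup>2"
    by (intro power_mono)
  then show ?thesis
    using assms by (simp add: norm_row_factor equispaced_phase r h_def[symmetric])
qed

text \<open>Modulo \<pi> the M phases form a grid of step \<pi>/M, so for any shift one of them lies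
  within \<pi>/(2M) of a zero of the sine.\<close>

lemma exists_row_factor_le:
  assumes "l \<noteq> 0" "0 < M"
  shows "\<exists>i<M. cmod (row_factor \<eta> l (equispaced_design M l \<alpha> (Suc i)))
    \<le> 2 * sqrt ((sinh (\<eta> * l / 2))\<^sup>2 + (sin (pi / (2 * real M)))\<^sup>2)"
proof -
  \<comment> \<open>Rounding picks the integer n for which \<alpha> + \<pi> n/M is nearest to 0.
    Reducing n modulo M gives an actual row and moves the phase by a multiple of \<pi>, which the
    squared sine does not see.\<close>
  define n where "n = round (- \<alpha> * real M / pi)"
  define i where "i = nat (n mod int M)"
  define q where "q = n div int M"
  have i: "i < M" using assms(2) by (simp add: i_def nat_less_iff)
  have "n = q * int M + int i" using assms(2) by (simp add: q_def i_def)
  then have n: "real_of_int n = real_of_int q * real M + real i" by simp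
  define \<theta> where "\<theta> = \<alpha> + pi * real_of_int n / real M"
  have le: "\<bar>real_of_int n - (- \<alpha> * real M / pi)\<bar> \<le> 1/2"
    unfolding n_def by (rule of_int_round_abs_le)
  have \<theta>': "\<theta> = (real_of_int n - (- \<alpha> * real M / pi)) * (pi / real M)"
    using assms(2) by (simp add: \<theta>_def field_simps)
  have "\<bar>\<theta>\<bar> \<le> 1/2 * (pi / real M)"
    unfolding \<theta>' abs_mult by (rule mult_mono[OF le]) simp_all
  then have \<theta>: "\<bar>\<theta>\<bar> \<le> pi / (2 * real M)" by simp
  have h: "pi / (2 * real M) \<le> pi / 2" using assms(2) by (simp add: field_simps)
  have \<phi>: "\<alpha> + pi * real i / real M = \<theta> - real_of_int q * pi"
    using assms(2) by (simp add: \<theta>_def n field_simps)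
  have "cos (2 * (\<alpha> + pi * real i / real M)) = cos (2 * \<theta> - 2 * pi * real_of_int q)"
    unfolding \<phi> by (simp add: algebra_simps)
  also have "\<dots> = cos (2 * \<theta>)" unfolding cos_diff by simp
  finally have "(sin (\<alpha> + pi * real i / real M))\<^sup>2 = (sin \<bar>\<theta>\<bar>)\<^sup>2"
    unfolding cos_double_sin by (simp add: abs_if)
  also have "\<dots> \<le> (sin (pi / (2 * real M)))\<^sup>2"
    using \<theta> h by (intro power_mono sin_monotone_2pi_le sin_ge_zero) auto
  finally show ?thesis
    using i assms by (intro exI[of _ i]) (simp add: norm_row_factor equispaced_phase)
qed

lemma image_Suc_1: "f ` {1..M} = (\<lambda>i. f (Suc i)) ` {..<M}"
proof -
  have "{1..M} = Suc ` {..<M}" by (simp add: image_Suc_lessThan)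
  then show ?thesis by (simp only: image_image)
qed

text \<open>One number separates the two minima: every shift has a row at or below it, and the
  half-shift has all rows at or above it.\<close>

lemma min_row_factor_le_half_shift:
  assumes "l \<noteq> 0" "0 < M"
  shows "Min ((\<lambda>k. cmod (row_factor \<eta> l (equispaced_design M l \<alpha> k))) ` {1..M})
    \<le> Min ((\<lambda>k. cmod (row_factor \<eta> l (equispaced_design M l (pi / (2 * real M)) k))) ` {1..M})"
proof -
  obtain i where i: "i < M" "cmod (row_factor \<eta> l (equispaced_design M l \<alpha> (Suc i)))
    \<le> 2 * sqrt ((sinh (\<eta> * l / 2))\<^sup>2 + (sin (pi / (2 * real M)))\<^sup>2)"
    using exists_row_factor_le[OF assms] by blast
  have "Min ((\<lambda>k. cmod (row_factor \<eta> l (equispaced_design M l \<alpha> k))) ` {1..M})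
      \<le> cmod (row_factor \<eta> l (equispaced_design M l \<alpha> (Suc i)))"
    unfolding image_Suc_1 using i by (intro Min_le) auto
  also note i(2)
  also have "2 * sqrt ((sinh (\<eta> * l / 2))\<^sup>2 + (sin (pi / (2 * real M)))\<^sup>2)
      \<le> Min ((\<lambda>k. cmod (row_factor \<eta> l (equispaced_design M l (pi / (2 * real M)) k))) ` {1..M})"
    unfolding image_Suc_1 using assms half_shift_row_factor_ge[OF assms(1)] by (subst Min_ge_iff) auto
  finally show ?thesis .
qed

lemma sigma_min_F_mat_equispaced:
  assumes "1 \<le> N" "N \<le> M" "l \<noteq> 0"
  shows "sigma_min_mat (F_mat l M N (equispaced_design M l \<alpha>)) = sqrt (real M)"
proof -
  have d: "dim_col (F_mat l M N (equispaced_design M l \<alpha>)) = N" by (simp add: F_mat_def)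
  have iso: "vec_norm2 (F_mat l M N (equispaced_design M l \<alpha>) *\<^sub>v u) = sqrt (real M)"
    if "u \<in> carrier_vec N" "vec_norm2 u = 1" for u
    using F_mat_equispaced_isometry[of N M l u \<alpha>] that assms by simp
  have "sigma_min N (\<lambda>u. F_mat l M N (equispaced_design M l \<alpha>) *\<^sub>v u) \<le> sqrt (real M)"
    using sigma_min_le[OF unit_vec_carrier vec_norm2_unit_vec, of 0 N "\<lambda>u. F_mat l M N (equispaced_design M l \<alpha>) *\<^sub>v u"]
      iso[OF unit_vec_carrier vec_norm2_unit_vec, of 0] assms by simp
  moreover have "sqrt (real M) \<le> sigma_min N (\<lambda>u. F_mat l M N (equispaced_design M l \<alpha>) *\<^sub>v u)"
    using assms(1) by (rule sigma_min_ge) (simp add: iso)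
  ultimately show ?thesis unfolding d by (rule antisym)
qed

text \<open>The lower bounds of the three factors multiply when they are applied to \<open>u\<close>
  one after another; the Fourier factor scales norms by exactly sqrt M.\<close>

lemma sigma_min_free_jacobian_half_shifted_ge:
  assumes "0 < \<Lambda>" "0 < \<eta>" "1 \<le> N" "N \<le> M" and l: "l = \<Lambda> / real N"
  shows "2 * sqrt (real M) * sqrt ((sinh (\<eta> * l / 2))\<^sup>2 + (sin (pi / (2 * real M)))\<^sup>2) * exp (- \<eta> * (\<Lambda> - l / 2))
    \<le> sigma_min N (free_jacobian \<Lambda> \<eta> M N (half_shifted_design M l))"
proof (rule sigma_min_ge[OF \<open>1 \<le> N\<close>])
  fix u :: "complex Matrix.vec" assume u: "u \<in> carrier_vec N" "vec_norm2 u = 1"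
  define x where "x = half_shifted_design M l"
  define g where "g = 2 * sqrt ((sinh (\<eta> * l / 2))\<^sup>2 + (sin (pi / (2 * real M)))\<^sup>2)"
  define w where "w = exp (- \<eta> * (\<Lambda> - l / 2))"
  have l0: "0 < l" using assms by simp
  have Nl: "\<Lambda> = real N * l" using assms by simp
  have c: "D_gamma \<eta> l M x \<in> carrier_mat M M" "F_mat l M N x \<in> carrier_mat M N" "D_w \<eta> l N \<in> carrier_mat N N"
    by (simp_all add: D_gamma_def F_mat_def D_w_def)
  have v: "D_w \<eta> l N *\<^sub>v u \<in> carrier_vec N" "F_mat l M N x *\<^sub>v (D_w \<eta> l N *\<^sub>v u) \<in> carrier_vec M"
    using c u by auto
  have T: "free_jacobian \<Lambda> \<eta> M N x u = D_gamma \<eta> l M x *\<^sub>v (F_mat l M N x *\<^sub>v (D_w \<eta> l N *\<^sub>v u))"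
    unfolding free_jacobian_factorization[OF assms(1-3) l u(1)]
    using c u v by (simp add: assoc_mult_mat_vec[of _ M N _ N] assoc_mult_mat_vec[of _ M M _ N])
  have "w * vec_norm2 u \<le> vec_norm2 (D_w \<eta> l N *\<^sub>v u)"
    unfolding D_w_def
  proof (rule vec_norm2_diag_ge[OF u(1)])
    fix j assume "j < N"
    then have "real j + 1 \<le> real N" by simp
    \<comment> \<open>Equality holds for j = N - 1: the last block has the smallest weight.\<close>
    then have "(real j + 1/2) * l \<le> \<Lambda> - l / 2"
      using mult_right_mono[of "real j + 1" "real N" l] l0 by (simp add: Nl algebra_simps)
    then have "\<eta> * ((real j + 1/2) * l) \<le> \<eta> * (\<Lambda> - l / 2)"
      using assms(2) by (intro mult_left_mono) auto
    then show "w \<le> cmod (of_real (exp (- \<eta> * (real j + 1/2) * l)))"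
      unfolding w_def by (simp add: mult.assoc)
  qed (simp add: w_def)
  moreover have "g * vec_norm2 (F_mat l M N x *\<^sub>v (D_w \<eta> l N *\<^sub>v u)) \<le> vec_norm2 (free_jacobian \<Lambda> \<eta> M N x u)"
    unfolding T unfolding D_gamma_def
    by (rule vec_norm2_diag_ge[OF v(2)])
      (use half_shift_row_factor_ge[of l _ M \<eta>] l0 in \<open>auto simp: g_def x_def half_shifted_design_eq\<close>)
  moreover have "vec_norm2 (F_mat l M N x *\<^sub>v (D_w \<eta> l N *\<^sub>v u)) = sqrt (real M) * vec_norm2 (D_w \<eta> l N *\<^sub>v u)"
    unfolding x_def half_shifted_design_eq using assms l0 v(1) by (intro F_mat_equispaced_isometry) auto
  moreover have "g * (sqrt (real M) * w) \<le> g * (sqrt (real M) * vec_norm2 (D_w \<eta> l N *\<^sub>v u))"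
    if "w \<le> vec_norm2 (D_w \<eta> l N *\<^sub>v u)"
    using that by (intro mult_left_mono) (auto simp: g_def)
  ultimately have "g * (sqrt (real M) * w) \<le> vec_norm2 (free_jacobian \<Lambda> \<eta> M N x u)"
    using u(2) by simp
  then show "2 * sqrt (real M) * sqrt ((sinh (\<eta> * l / 2))\<^sup>2 + (sin (pi / (2 * real M)))\<^sup>2) * exp (- \<eta> * (\<Lambda> - l / 2))
      \<le> vec_norm2 (free_jacobian \<Lambda> \<eta> M N (half_shifted_design M l) u)"
    unfolding g_def w_def x_def by (simp add: mult_ac)
qed

theorem theorem1p3:
  fixes \<Lambda> \<eta> l :: real and M N :: nat
  assumes "\<Lambda> > 0" and "\<eta> > 0" and "1 \<le> N" and "N \<le> M" and l: "l = \<Lambda> / real N"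
  shows
    \<comment> \<open>(1)\<close>
    "(\<forall>x :: nat \<Rightarrow> real.
        (\<forall>\<Delta>q \<in> carrier_vec N. \<forall>k \<in> {1..M}.
           schur_path \<Lambda> (Complex (x k) \<eta>) (block_function \<Lambda> N \<Delta>q) differentiable (at 0)) \<and>
        (\<forall>\<Delta>q \<in> carrier_vec N.
           free_jacobian \<Lambda> \<eta> M N x \<Delta>q = (D_gamma \<eta> l M x * F_mat l M N x * D_w \<eta> l N) *\<^sub>v \<Delta>q)) \<and>
     \<comment> \<open>(2)\<close>
     (\<forall>x :: nat \<Rightarrow> real.
        sigma_min N (free_jacobian \<Lambda> \<eta> M N x)
          \<le> 2 * sqrt (real M) * cosh (\<eta> * l / 2) * exp (- \<eta> * (\<Lambda> - l / 2))) \<and>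
     \<comment> \<open>(3)\<close>
     sigma_min N (free_jacobian \<Lambda> \<eta> M N (half_shifted_design M l))
       \<ge> 2 * sqrt (real M) * sqrt ((sinh (\<eta> * l / 2))\<^sup>2 + (sin (pi / (2 * real M)))\<^sup>2)
            * exp (- \<eta> * (\<Lambda> - l / 2)) \<and>
     \<comment> \<open>(4)\<close>
     (\<forall>\<alpha> :: real.
        Min ((\<lambda>k. cmod (row_factor \<eta> l (equispaced_design M l \<alpha> k))) ` {1..M})
          \<le> Min ((\<lambda>k. cmod (row_factor \<eta> l (equispaced_design M l (pi / (2 * real M)) k))) ` {1..M})) \<and>
     (\<forall>\<alpha> :: real.
        sigma_min_mat (D_gamma \<eta> l M (equispaced_design M l \<alpha>))
          * sigma_min_mat (F_mat l M N (equispaced_design M l \<alpha>)) * sigma_min_mat (D_w \<eta> l N)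
        \<le> sigma_min_mat (D_gamma \<eta> l M (equispaced_design M l (pi / (2 * real M))))
          * sigma_min_mat (F_mat l M N (equispaced_design M l (pi / (2 * real M))))
          * sigma_min_mat (D_w \<eta> l N))"
proof (intro conjI allI ballI)
  have l0: "0 < l" "l \<noteq> 0" and M: "0 < M" "1 \<le> M"
    using assms by auto
  \<comment> \<open>Differentiability makes the \<open>vector_derivative\<close> in the free
    Jacobian a genuine derivative.\<close>
  show "schur_path \<Lambda> (Complex (x k) \<eta>) (block_function \<Lambda> N \<Delta>q) differentiable (at 0)" for x :: "nat \<Rightarrow> real" and \<Delta>q k
    by (rule differentiableI_vector, rule schur_path_has_vector_derivative) (use assms in simp_all)
  show "free_jacobian \<Lambda> \<eta> M N x \<Delta>q = (D_gamma \<eta> l M x * F_mat l M N x * D_w \<eta> l N) *\<^sub>v \<Delta>q"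
    if "\<Delta>q \<in> carrier_vec N" for x \<Delta>q
    using assms that by (intro free_jacobian_factorization)
  show "sigma_min N (free_jacobian \<Lambda> \<eta> M N x)
      \<le> 2 * sqrt (real M) * cosh (\<eta> * l / 2) * exp (- \<eta> * (\<Lambda> - l / 2))" for x
    using assms by (intro sigma_min_free_jacobian_le)
  show "2 * sqrt (real M) * sqrt ((sinh (\<eta> * l / 2))\<^sup>2 + (sin (pi / (2 * real M)))\<^sup>2)
      * exp (- \<eta> * (\<Lambda> - l / 2)) \<le> sigma_min N (free_jacobian \<Lambda> \<eta> M N (half_shifted_design M l))"
    using assms by (intro sigma_min_free_jacobian_half_shifted_ge)
  show min_le: "Min ((\<lambda>k. cmod (row_factor \<eta> l (equispaced_design M l \<alpha> k))) ` {1..M})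
      \<le> Min ((\<lambda>k. cmod (row_factor \<eta> l (equispaced_design M l (pi / (2 * real M)) k))) ` {1..M})" for \<alpha>
    using l0 M by (intro min_row_factor_le_half_shift)
  show "sigma_min_mat (D_gamma \<eta> l M (equispaced_design M l \<alpha>))
          * sigma_min_mat (F_mat l M N (equispaced_design M l \<alpha>)) * sigma_min_mat (D_w \<eta> l N)
        \<le> sigma_min_mat (D_gamma \<eta> l M (equispaced_design M l (pi / (2 * real M))))
          * sigma_min_mat (F_mat l M N (equispaced_design M l (pi / (2 * real M))))
          * sigma_min_mat (D_w \<eta> l N)" for \<alpha>
  proof -
    \<comment> \<open>Only this factor varies with \<alpha>: the Fourier factor always has least
      singular value sqrt M, and the column weights do not involve the design.\<close>
    have "sigma_min_mat (D_gamma \<eta> l M (equispaced_design M l \<alpha>))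
        \<le> sigma_min_mat (D_gamma \<eta> l M (equispaced_design M l (pi / (2 * real M))))"
      unfolding D_gamma_def sigma_min_mat_diag[OF M(2)] using min_le unfolding image_Suc_1 .
    moreover have "0 \<le> sigma_min_mat (D_w \<eta> l N)"
      using assms(3) by (intro sigma_min_ge) (simp_all add: D_w_def mat_diag_def)
    ultimately show ?thesis
      unfolding sigma_min_F_mat_equispaced[OF assms(3,4) l0(2)] by (intro mult_right_mono) auto
  qed
qed

end
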